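(* In the setting of the context, let $\lambda_0,\lambda_1>0$ and let $N\ge1$ be an integer. Let a truncated group-sequential test $(\psi,\phi)\in\mathscr S^N$ be such that conditions $\mathfrak S_N(\psi)$ and $\mathfrak D(\psi,\phi)$ are satisfied. Then for all truncated tests $(\psi',\phi')\in\mathscr S^N$ such that $$\alpha(\psi',\phi')\le\alpha(\psi,\phi)\quad\text{and}\quad\beta(\psi',\phi')\le\beta(\psi,\phi)\qquad(1)$$ it holds $$K_0(\psi')\ge K_0(\psi).\qquad(2)$$ The inequality in (2) is strict if at least one of the inequalities in (1) is strict. If there are equalities in all the inequalities in (1) and (2), then conditions $\mathfrak S_N(\psi')$ and $\mathfrak D(\psi',\phi')$ are satisfied for $(\psi',\phi')$.
   Context: Setting. Observations arrive in groups $k=1,2,\dots$ of random sizes $\nu_1,\nu_2,\dots$, which are independent with values in $\mathscr G\subset\{0,1,2,\dots\}$ and known p.m.f.s $p_k(m)=P(\nu_k=m)$, $m\in\mathscr G$. For $n=(n_1,\dots,n_k)\in\mathscr G^k$ put $p(n)=\prod_{i=1}^kp_i(n_i)$, and $\mathcal P_k=\{n\in\mathscr G^k:p(n)>0\}$. Given the group sizes, all observations $X_{ij}$ ($j\le n_i$, $i\le k$) are i.i.d. with values in a measurable space $(\mathfrak X,\mathscr X)$ and density $f_\theta$ with respect to a $\sigma$-finite measure $\mu$, $\theta\in\{\theta_0,\theta_1\}$. Thus, given sizes $n$, the data $X^{(n)}=(X_1^{(n_1)},\dots,X_k^{(n_k)})$, $X_i^{(n_i)}=(X_{i1},\dots,X_{in_i})$,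 has density $f_\theta^{(n)}(x^{(n)})=\prod_{i=1}^k\prod_{j=1}^{n_i}f_\theta(x_{ij})$ with respect to $\mu^n=\mu^{n_1}\otimes\cdots\otimes\mu^{n_k}$ on $\mathfrak X^n=\mathfrak X^{n_1}\times\cdots\times\mathfrak X^{n_k}$ (empty products are $1$; $\mathfrak X^0$ is a one-point space and $\mu^0$ a probability measure on it). For a function $F_n$ on $\mathfrak X^n$, $E_\theta F_n=\int F_nf_\theta^{(n)}d\mu^n$. Write $f_i,E_i,P_i$ for $f_{\theta_i},E_{\theta_i},P_{\theta_i}$, $i=0,1$. It is assumed that $\mu\{x:f_0(x)\ne f_1(x)\}>0$. Tests. A stopping rule $\psi$ is a family of measurable functions $\psi_n:\mathfrak X^n\to[0,1]$, $n\in\mathscr G^k$, $k\ge1$ (conditional probability of stopping after the observed groups); a decision rule $\phi$ is a family of measurable $\phi_n:\mathfrak X^n\to[0,1]$ (conditional probability of rejecting $H_0:\theta=\theta_0$ in favour of $H_1:\theta=\theta_1$). A group-sequential test is a pair $(\psi,\phi)$. For $n=(n_1,\dots,n_k)$ let $t_n^\psi(x^{(n)})=\prod_{i=1}^{k-1}\bigl(1-\psi_{(n_1,\dots,n_i)}(x_1^{(n_1)},\dots,x_i^{(n_i)})\bigr)$ (equal to $1$ for $k=1$), $s_n^\psi=t_n^\psi\psi_n$, $S_n^\psi=\{x^{(n)}:s_n^\psi(x^{(n)})>0\}$, $T_n^\psi=\{x^{(n)}:t_n^\psi(x^{(n)})>0\}$. Truncated stopping rules: $\mathscr F^N=\{\psi:(1-\psi_{(n_1)})(1-\psi_{(n_1,n_2)})\cdots(1-\psi_{(n_1,\dots,n_N)})\equiv0\text{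 for all }(n_1,\dots,n_N)\in\mathscr G^N\}$; $\mathscr S^N$ is the set of all tests $(\psi,\phi)$ with $\psi\in\mathscr F^N$. Error probabilities: $\alpha(\psi,\phi)=\sum_{k\ge1}\sum_{n\in\mathscr G^k}p(n)E_0s_n^\psi\phi_n$, $\beta(\psi,\phi)=\sum_{k\ge1}\sum_{n\in\mathscr G^k}p(n)E_1s_n^\psi(1-\phi_n)$. Costs: $c(m)>0$ for $m\in\mathscr G$; $c(n)=\sum_{i=1}^kc(n_i)$ for $n\in\mathscr G^k$; $\bar c_k=\sum_{m\in\mathscr G}p_k(m)c(m)$, assumed to satisfy $0<\bar c_k<\infty$ for all $k$. $K_0(\psi)=\sum_{k\ge1}\sum_{n\in\mathscr G^k}p(n)c(n)E_0s_n^\psi$. Likelihood ratio: $z_n=f_1^{(n)}(x^{(n)})/f_0^{(n)}(x^{(n)})$ if $f_0^{(n)}(x^{(n)})>0$, $z_n=\infty$ if $f_0^{(n)}(x^{(n)})=0<f_1^{(n)}(x^{(n)})$, and $z_n=0$ (or any other value) otherwise. Let $g(z)=\min\{\lambda_0,\lambda_1z\}$, $z\ge0$. Define on $z\ge0$: $V_N^N(z)=g(z)$ and, for $k=N,N-1,\dots,2$, $V_{k-1}^N(z)=\min\{g(z),\ \bar c_k+\sum_{m\in\mathscr G}p_k(m)E_0V_k^N(zz_m)\}$; $\bar V_k^N(z)=\sum_{m\in\mathscr G}p_k(m)E_0V_k^N(zz_m)$, $1\le k\le N$ (here $z_m$ is the likelihood ratio of a single group of size $m$). Notation: $\psi\simeq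 I_{\{F_1\preccurlyeq F_2\}}$ means $I_{\{F_1<F_2\}}\le\psi\le I_{\{F_1\le F_2\}}$. Condition $\mathfrak S_N(\psi)$: for all $1\le k<N$ and all $n\in\mathcal P_k$, $\psi_n\simeq I_{\{g(z_n)\preccurlyeq\bar c_{k+1}+\bar V_{k+1}^N(z_n)\}}$ $P_0$-almost surely on $T_n^\psi$ (i.e. for $\mu^n$-almost every $x^{(n)}\in T_n^\psi\cap\{f_0^{(n)}>0\}$). Condition $\mathfrak D(\psi,\phi)$: for all $k\ge1$ and all $n\in\mathcal P_k$, $\phi_n\simeq I_{\{\lambda_0/\lambda_1\preccurlyeq z_n\}}$ $P_0$-almost surely on $S_n^\psi$.
   Formalization: Condition D for (ψ,φ) is required P_1-almost surely as well as P_0-almost surely (so φ_n = 1 on S_n where f_0^(n) = 0 < f_1^(n)), since strictness fails otherwise; D for (ψ',φ') is likewise concluded under both. *)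

theory Defs
  imports "HOL-Probability.Probability"
begin

text \<open>
  Groups are numbered from \<open>1\<close> in \<open>p k\<close> (the distribution of the size of the \<open>k\<close>-th group) and in
  all stage indices, but the \<open>i\<close>-th entry of a size vector \<open>n\<close> is \<open>n ! (i - 1)\<close>.
  The observation \<open>X\<^sub>i\<^sub>j\<close> is \<open>x (i - 1) (j - 1)\<close>.
  Expectations, error probabilities, costs and the functions \<open>V\<close> are nonnegative and are taken
  in \<^typ>\<open>ennreal\<close>, so that all integrals and infinite sums are defined without side conditions.
\<close>

locale group_sequential_model = sigma_finite_measure M
  for M :: "'a measure" +
  fixes f0 f1 :: "'a \<Rightarrow> real" and G :: "nat set" and p :: "nat \<Rightarrow> nat pmf" and c :: "nat \<Rightarrow> real"
  assumes f0_measurable: "f0 \<in> borel_measurable M"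
    and f1_measurable: "f1 \<in> borel_measurable M"
    and f0_nonneg: "\<And>x. x \<in> space M \<Longrightarrow> 0 \<le> f0 x"
    and f1_nonneg: "\<And>x. x \<in> space M \<Longrightarrow> 0 \<le> f1 x"
    and f0_density: "(\<integral>\<^sup>+x. ennreal (f0 x) \<partial>M) = 1"
    and f1_density: "(\<integral>\<^sup>+x. ennreal (f1 x) \<partial>M) = 1"
    and f0_neq_f1: "emeasure M {x \<in> space M. f0 x \<noteq> f1 x} > 0"
    and sizes: "\<And>k. 1 \<le> k \<Longrightarrow> set_pmf (p k) \<subseteq> G"
    and cost_pos: "\<And>m. m \<in> G \<Longrightarrow> 0 < c m"
    and mean_cost: "\<And>k. 1 \<le> k \<Longrightarrow>
      0 < (\<Sum>\<^sub>\<infinity>m\<in>G. ennreal (pmf (p k) m * c m)) \<and> (\<Sum>\<^sub>\<infinity>m\<in>G. ennreal (pmf (p k) m * c m)) < \<infinity>"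

definition size_vectors :: "nat set \<Rightarrow> nat \<Rightarrow> nat list set" where
  "size_vectors G k = {n. length n = k \<and> set n \<subseteq> G}"

definition size_prob :: "(nat \<Rightarrow> nat pmf) \<Rightarrow> nat list \<Rightarrow> real" where
  "size_prob p n = (\<Prod>i<length n. pmf (p (Suc i)) (n ! i))"

definition pos_size_vectors :: "nat set \<Rightarrow> (nat \<Rightarrow> nat pmf) \<Rightarrow> nat \<Rightarrow> nat list set" where
  "pos_size_vectors G p k = {n \<in> size_vectors G k. size_prob p n > 0}"

definition sample_space :: "'a measure \<Rightarrow> nat list \<Rightarrow> (nat \<Rightarrow> nat \<Rightarrow> 'a) measure" where
  "sample_space M n = (\<Pi>\<^sub>M i\<in>{..<length n}. \<Pi>\<^sub>M j\<in>{..<n ! i}. M)"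

definition joint_density :: "('a \<Rightarrow> real) \<Rightarrow> nat list \<Rightarrow> (nat \<Rightarrow> nat \<Rightarrow> 'a) \<Rightarrow> real" where
  "joint_density f n x = (\<Prod>i<length n. \<Prod>j<n ! i. f (x i j))"

definition expect ::
  "'a measure \<Rightarrow> ('a \<Rightarrow> real) \<Rightarrow> nat list \<Rightarrow> ((nat \<Rightarrow> nat \<Rightarrow> 'a) \<Rightarrow> ennreal) \<Rightarrow> ennreal" where
  "expect M f n F = (\<integral>\<^sup>+x. F x * ennreal (joint_density f n x) \<partial>sample_space M n)"

text \<open>Stopping rules and decision rules are families of the same kind.\<close>

type_synonym 'a rule = "nat list \<Rightarrow> (nat \<Rightarrow> nat \<Rightarrow> 'a) \<Rightarrow> real"

definition rules :: "'a measure \<Rightarrow> nat set \<Rightarrow> 'a rule set" where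
  "rules M G = {\<psi>. \<forall>k\<ge>1. \<forall>n\<in>size_vectors G k.
     \<psi> n \<in> borel_measurable (sample_space M n) \<and>
     (\<forall>x\<in>space (sample_space M n). 0 \<le> \<psi> n x \<and> \<psi> n x \<le> 1)}"

text \<open>\<open>restrict x {..<i}\<close> is the data of the first \<open>i\<close> groups as a point of \<open>sample_space M (take i n)\<close>.\<close>

definition continue_prob :: "'a rule \<Rightarrow> nat list \<Rightarrow> (nat \<Rightarrow> nat \<Rightarrow> 'a) \<Rightarrow> real" where
  "continue_prob \<psi> n x = (\<Prod>i\<in>{1..<length n}. 1 - \<psi> (take i n) (restrict x {..<i}))"

definition stop_prob :: "'a rule \<Rightarrow> nat list \<Rightarrow> (nat \<Rightarrow> nat \<Rightarrow> 'a) \<Rightarrow> real" where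
  "stop_prob \<psi> n x = continue_prob \<psi> n x * \<psi> n x"

definition truncated_rules :: "'a measure \<Rightarrow> nat set \<Rightarrow> nat \<Rightarrow> 'a rule set" where
  "truncated_rules M G N = {\<psi> \<in> rules M G. \<forall>n\<in>size_vectors G N. \<forall>x\<in>space (sample_space M n).
     (\<Prod>i\<in>{1..N}. 1 - \<psi> (take i n) (restrict x {..<i})) = 0}"

definition truncated_tests :: "'a measure \<Rightarrow> nat set \<Rightarrow> nat \<Rightarrow> ('a rule \<times> 'a rule) set" where
  "truncated_tests M G N = truncated_rules M G N \<times> rules M G"

definition alpha ::
  "'a measure \<Rightarrow> ('a \<Rightarrow> real) \<Rightarrow> nat set \<Rightarrow> (nat \<Rightarrow> nat pmf) \<Rightarrow> 'a rule \<Rightarrow> 'a rule \<Rightarrow> ennreal" where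
  "alpha M f0 G p \<psi> \<phi> = (\<Sum>\<^sub>\<infinity>k\<in>{1..}. \<Sum>\<^sub>\<infinity>n\<in>size_vectors G k.
     ennreal (size_prob p n) * expect M f0 n (\<lambda>x. ennreal (stop_prob \<psi> n x * \<phi> n x)))"

definition beta ::
  "'a measure \<Rightarrow> ('a \<Rightarrow> real) \<Rightarrow> nat set \<Rightarrow> (nat \<Rightarrow> nat pmf) \<Rightarrow> 'a rule \<Rightarrow> 'a rule \<Rightarrow> ennreal" where
  "beta M f1 G p \<psi> \<phi> = (\<Sum>\<^sub>\<infinity>k\<in>{1..}. \<Sum>\<^sub>\<infinity>n\<in>size_vectors G k.
     ennreal (size_prob p n) * expect M f1 n (\<lambda>x. ennreal (stop_prob \<psi> n x * (1 - \<phi> n x))))"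

definition mean_group_cost :: "nat set \<Rightarrow> (nat \<Rightarrow> nat pmf) \<Rightarrow> (nat \<Rightarrow> real) \<Rightarrow> nat \<Rightarrow> ennreal" where
  "mean_group_cost G p c k = (\<Sum>\<^sub>\<infinity>m\<in>G. ennreal (pmf (p k) m * c m))"

definition K0 ::
  "'a measure \<Rightarrow> ('a \<Rightarrow> real) \<Rightarrow> nat set \<Rightarrow> (nat \<Rightarrow> nat pmf) \<Rightarrow> (nat \<Rightarrow> real) \<Rightarrow> 'a rule \<Rightarrow> ennreal" where
  "K0 M f0 G p c \<psi> = (\<Sum>\<^sub>\<infinity>k\<in>{1..}. \<Sum>\<^sub>\<infinity>n\<in>size_vectors G k.
     ennreal (size_prob p n) * ennreal (\<Sum>i<k. c (n ! i)) *
     expect M f0 n (\<lambda>x. ennreal (stop_prob \<psi> n x)))"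

definition lik_ratio ::
  "('a \<Rightarrow> real) \<Rightarrow> ('a \<Rightarrow> real) \<Rightarrow> nat list \<Rightarrow> (nat \<Rightarrow> nat \<Rightarrow> 'a) \<Rightarrow> ennreal" where
  "lik_ratio f0 f1 n x =
     (if joint_density f0 n x > 0 then ennreal (joint_density f1 n x / joint_density f0 n x)
      else if joint_density f1 n x > 0 then \<infinity> else 0)"

definition stop_loss :: "real \<Rightarrow> real \<Rightarrow> ennreal \<Rightarrow> ennreal" where
  "stop_loss l0 l1 z = min (ennreal l0) (ennreal l1 * z)"

definition next_mean ::
  "'a measure \<Rightarrow> ('a \<Rightarrow> real) \<Rightarrow> ('a \<Rightarrow> real) \<Rightarrow> nat set \<Rightarrow> (nat \<Rightarrow> nat pmf) \<Rightarrow> nat \<Rightarrow>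
   (ennreal \<Rightarrow> ennreal) \<Rightarrow> ennreal \<Rightarrow> ennreal" where
  "next_mean M f0 f1 G p k W z =
     (\<Sum>\<^sub>\<infinity>m\<in>G. ennreal (pmf (p k) m) * expect M f0 [m] (\<lambda>x. W (z * lik_ratio f0 f1 [m] x)))"

text \<open>
  \<open>V \<dots> N k\<close> is \<open>V\<^sub>k\<^sup>N\<close>. Only \<open>1 \<le> k \<le> N\<close> is meaningful. The argument \<open>z\<close> may be \<open>\<infinity>\<close> here, but
  this value only ever occurs where \<open>f0\<close> has zero joint density.
\<close>

function V ::
  "'a measure \<Rightarrow> ('a \<Rightarrow> real) \<Rightarrow> ('a \<Rightarrow> real) \<Rightarrow> nat set \<Rightarrow> (nat \<Rightarrow> nat pmf) \<Rightarrow> (nat \<Rightarrow> real) \<Rightarrow>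
   real \<Rightarrow> real \<Rightarrow> nat \<Rightarrow> nat \<Rightarrow> ennreal \<Rightarrow> ennreal" where
  "V M f0 f1 G p c l0 l1 N k =
     (if N \<le> k then stop_loss l0 l1
      else (\<lambda>z. min (stop_loss l0 l1 z)
        (mean_group_cost G p c (k + 1) +
         next_mean M f0 f1 G p (k + 1) (V M f0 f1 G p c l0 l1 N (k + 1)) z)))"
  by auto
termination
  by (relation "Wellfounded.measure (\<lambda>(_, _, _, _, _, _, _, _, N, k). N - k)") auto

declare V.simps [simp del]

definition V_bar ::
  "'a measure \<Rightarrow> ('a \<Rightarrow> real) \<Rightarrow> ('a \<Rightarrow> real) \<Rightarrow> nat set \<Rightarrow> (nat \<Rightarrow> nat pmf) \<Rightarrow> (nat \<Rightarrow> real) \<Rightarrow>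
   real \<Rightarrow> real \<Rightarrow> nat \<Rightarrow> nat \<Rightarrow> ennreal \<Rightarrow> ennreal" where
  "V_bar M f0 f1 G p c l0 l1 N k z = next_mean M f0 f1 G p k (V M f0 f1 G p c l0 l1 N k) z"

text \<open>\<open>between_indicators u a b\<close> is \<open>u \<simeq> I\<^bsub>{a \<preceq> b}\<^esub>\<close>.\<close>

definition between_indicators :: "real \<Rightarrow> ennreal \<Rightarrow> ennreal \<Rightarrow> bool" where
  "between_indicators u a b \<longleftrightarrow> of_bool (a < b) \<le> u \<and> u \<le> of_bool (a \<le> b)"

definition cond_S ::
  "'a measure \<Rightarrow> ('a \<Rightarrow> real) \<Rightarrow> ('a \<Rightarrow> real) \<Rightarrow> nat set \<Rightarrow> (nat \<Rightarrow> nat pmf) \<Rightarrow> (nat \<Rightarrow> real) \<Rightarrow>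
   real \<Rightarrow> real \<Rightarrow> nat \<Rightarrow> 'a rule \<Rightarrow> bool" where
  "cond_S M f0 f1 G p c l0 l1 N \<psi> \<longleftrightarrow> (\<forall>k. 1 \<le> k \<and> k < N \<longrightarrow> (\<forall>n\<in>pos_size_vectors G p k.
     AE x in sample_space M n. continue_prob \<psi> n x > 0 \<and> joint_density f0 n x > 0 \<longrightarrow>
       between_indicators (\<psi> n x) (stop_loss l0 l1 (lik_ratio f0 f1 n x))
         (mean_group_cost G p c (k + 1) + V_bar M f0 f1 G p c l0 l1 N (k + 1) (lik_ratio f0 f1 n x))))"

text \<open>
  Condition \<open>D\<close> with "almost surely" referring to the distribution with density \<open>h\<close>:
  \<open>h = f0\<close> gives the \<open>P\<^sub>0\<close>-almost sure condition. For \<open>h = f1\<close> it adds, on \<open>f0 = 0 < f1\<close> (where the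
  likelihood ratio is \<open>\<infinity>\<close>), that the hypothesis \<open>H\<^sub>0\<close> is rejected. The \<open>P\<^sub>0\<close>-condition leaves the decision
  on that set free, although \<open>beta\<close> depends on it. If \<open>f0 > 0\<close> wherever \<open>f1 > 0\<close>, then the case
  \<open>h = f1\<close> is implied by the case \<open>h = f0\<close>.
\<close>

definition cond_D ::
  "'a measure \<Rightarrow> ('a \<Rightarrow> real) \<Rightarrow> ('a \<Rightarrow> real) \<Rightarrow> ('a \<Rightarrow> real) \<Rightarrow> nat set \<Rightarrow> (nat \<Rightarrow> nat pmf) \<Rightarrow>
   real \<Rightarrow> real \<Rightarrow> 'a rule \<Rightarrow> 'a rule \<Rightarrow> bool" where
  "cond_D M h f0 f1 G p l0 l1 \<psi> \<phi> \<longleftrightarrow> (\<forall>k\<ge>1. \<forall>n\<in>pos_size_vectors G p k.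
     AE x in sample_space M n. stop_prob \<psi> n x > 0 \<and> joint_density h n x > 0 \<longrightarrow>
       between_indicators (\<phi> n x) (ennreal (l0 / l1)) (lik_ratio f0 f1 n x))"

end

theory Submission
  imports Defs
begin

text \<open>
  Lagrange multipliers: the weighted sum \<open>K0 + l0 * alpha + l1 * beta\<close> of a truncated test equals
  a constant, the value of the optimal stopping problem with terminal loss \<open>min (l0 * f0) (l1 * f1)\<close>,
  plus the nonnegative integrals of the losses incurred by departing from the optimal stopping and
  decision actions. These integrals all vanish iff the optimality conditions hold almost surely, so
  a test satisfying the conditions minimises the weighted sum. The constant is finite, hence
  smaller error probabilities must be paid for by a larger cost, and equality throughout forces
  the other test to attain the minimum as well.
\<close>

text \<open>The weighted sum mixes integrals under \<open>f0\<close> and under \<open>f1\<close>, so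
  everything is integrated against products of \<open>M\<close>, with the densities kept as factors.
  Where \<open>f0\<close> vanishes the likelihood ratio may be infinite, but in the integrands it is
  always multiplied by \<open>joint_density f0\<close>. The error of the second kind does see the
  set f0 = 0 < f1: the only optimal decision there is to reject, which the P0-almost sure decision
  condition does not express; hence the condition under both densities. Nonnegative extended reals
  have no general cancellation, so each comparison is an exact identity with the loss added on one
  side, and cancellation waits until the constant is known to be finite. \<open>V\<close> enters as
  the value of optimal continuation: at each stage a randomised rule averages the loss of stopping
  and the loss of continuing, and an average exceeds the minimum by a nonnegative amount.\<close>

section \<open>Countable sums as integrals, and inequalities for weighted sums\<close>

text \<open>The definitions use infinite sums of nonnegative values; as integrals over counting
  measure they obey linearity, Tonelli's theorem and the criterion for vanishing.\<close>

lemma infsum_eq_nn_integral_count_space: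
  fixes f :: "'b::countable \<Rightarrow> ennreal"
  shows "infsum f A = (\<integral>\<^sup>+x. f x \<partial>count_space A)"
proof -
  have sum_eq: "sum f F = (\<integral>\<^sup>+x. f x * indicator F x \<partial>count_space A)" if "finite F" "F \<subseteq> A" for F
    using that
    by (subst nn_integral_count_space'[of F]) (auto simp: indicator_def intro!: sum.cong)
  \<comment> \<open>\<open>to_nat\<close> enumerates the type, so the \<open>F i\<close> are an
    increasing sequence of finite sets exhausting \<open>A\<close>, as monotone convergence for
    sequences requires.\<close>
  define F where "F i = A \<inter> to_nat -` {..<i}" for i
  have F: "finite (F i)" "F i \<subseteq> A" for i
  proof -
    have "finite (to_nat -` {..<i} :: 'b set)" by (intro finite_vimageI) auto
    then show "finite (F i)" unfolding F_def by auto
  qed (auto simp: F_def)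
  have inf: "infsum f A = (SUP F\<in>{F. finite F \<and> F \<subseteq> A}. sum f F)"
    by (rule nonneg_infsum_complete) simp
  have "(\<integral>\<^sup>+x. f x \<partial>count_space A) = (\<integral>\<^sup>+x. (SUP i. f x * indicator (F i) x) \<partial>count_space A)"
  proof (rule nn_integral_cong)
    fix x assume x: "x \<in> space (count_space A)"
    have "f x \<le> (SUP i. f x * indicator (F i) x)"
      by (rule SUP_upper2[of "Suc (to_nat x)"]) (use x in \<open>auto simp: F_def\<close>)
    moreover have "(SUP i. f x * indicator (F i) x) \<le> f x"
      by (intro SUP_least) (auto simp: indicator_def)
    ultimately show "f x = (SUP i. f x * indicator (F i) x)" by simp
  qed
  also have "\<dots> = (SUP i. \<integral>\<^sup>+x. f x * indicator (F i) x \<partial>count_space A)"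
  proof (rule nn_integral_monotone_convergence_SUP)
    show "incseq (\<lambda>i x. f x * indicator (F i) x)"
      by (auto simp: incseq_def le_fun_def F_def indicator_def intro!: mult_left_mono)
  qed simp
  also have "\<dots> = (SUP i. sum f (F i))"
    by (intro SUP_cong refl) (simp add: sum_eq F)
  also have "\<dots> \<le> infsum f A"
    unfolding inf by (rule SUP_subset_mono[where g = "sum f" and f = "sum f" and A = "range F", simplified image_image]) (use F in auto)
  finally have "(\<integral>\<^sup>+x. f x \<partial>count_space A) \<le> infsum f A" .
  moreover have "infsum f A \<le> (\<integral>\<^sup>+x. f x \<partial>count_space A)"
    unfolding inf
    by (intro SUP_least) (auto simp: sum_eq indicator_def intro!: nn_integral_mono)
  ultimately show ?thesis by simp
qed

lemma borel_measurable_nn_integral_count_space_nat: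
  fixes A :: "nat set"
  assumes "\<And>m. m \<in> A \<Longrightarrow> f m \<in> borel_measurable L"
  shows "(\<lambda>x. \<integral>\<^sup>+m. f m x \<partial>count_space A) \<in> borel_measurable L"
proof -
  have "(\<lambda>x. \<Sum>m. f m x * indicator A m) \<in> borel_measurable L"
    using assms by (intro borel_measurable_suminf_order) (auto simp: indicator_def)
  then show ?thesis
    by (simp add: nn_integral_count_space_indicator nn_integral_count_space_nat)
qed

text \<open>Finiteness of the left sum makes all its terms finite, hence cancellable;
  \<open>k'\<close> may still be infinite. For strictness, \<open>k' = k\<close> would force a \<le>
  a' and b \<le> b' after cancelling the other terms.\<close>

lemma ennreal_weighted_sum_cancel:
  fixes k k' a a' b b' u w :: ennreal
  assumes le: "k + u * a + w * b \<le> k' + u * a' + w * b'" and fin: "k + u * a + w * b < \<top>"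
    and a: "a' \<le> a" and b: "b' \<le> b" and u: "u \<noteq> 0" "u \<noteq> \<top>" and w: "w \<noteq> 0" "w \<noteq> \<top>"
  shows "k \<le> k'" and "a' < a \<or> b' < b \<Longrightarrow> k < k'"
proof -
  have fins: "k \<noteq> \<top>" "u * a \<noteq> \<top>" "w * b \<noteq> \<top>" using fin by auto
  have mono: "u * a' \<le> u * a" "w * b' \<le> w * b" using a b by (simp_all add: mult_left_mono)
  have cancel: "y \<le> z" if "x + y \<le> x + z" "x \<noteq> \<top>" for x y z :: ennreal
    using that by (simp add: ennreal_add_left_cancel_le)
  have "(u * a + w * b) + k \<le> (u * a' + w * b') + k'"
    using le by (simp add: ac_simps)
  also have "\<dots> \<le> (u * a + w * b) + k'"
    by (intro add_right_mono add_mono mono)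
  finally have "(u * a + w * b) + k \<le> (u * a + w * b) + k'" .
  then show kk: "k \<le> k'" by (rule cancel) (use fins in simp)
  assume strict: "a' < a \<or> b' < b"
  show "k < k'"
  proof (rule ccontr)
    assume "\<not> k < k'"
    with kk have "k' = k" by simp
    with le have "k + (u * a + w * b) \<le> k + (u * a' + w * b')" by (simp add: add.assoc)
    then have sum: "u * a + w * b \<le> u * a' + w * b'" by (rule cancel) (rule fins)
    have "w * b + u * a \<le> w * b + u * a'"
      using order_trans[OF sum add_left_mono[OF mono(2)]] by (simp add: add.commute)
    then have "u * a \<le> u * a'" by (rule cancel) (rule fins)
    moreover have "u * a + w * b \<le> u * a + w * b'"
      by (rule order_trans[OF sum add_right_mono[OF mono(1)]])
    then have "w * b \<le> w * b'" by (rule cancel) (rule fins)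
    ultimately show False
      using strict u w by (auto simp: ennreal_mult_le_mult_iff)
  qed
qed

text \<open>A randomised decision pays an average of the losses of the two decisions. This keeps the
  argument of \<open>ennreal\<close> in \<open>decision_excess\<close> nonnegative, so that nothing
  is cut off at 0.\<close>

lemma min_le_convex_combination:
  fixes a b u :: real
  assumes "0 \<le> u" "u \<le> 1"
  shows "min a b \<le> a * u + b * (1 - u)"
proof -
  have "min a b * u + min a b * (1 - u) \<le> a * u + b * (1 - u)"
    using assms by (intro add_mono mult_right_mono) auto
  then show ?thesis by (simp add: algebra_simps)
qed

section \<open>Size vectors extended by one group\<close>

lemma snoc_size_vectors_bij:
  "bij_betw (\<lambda>(n, m). n @ [m]) (size_vectors G k \<times> G) (size_vectors G (Suc k))"
  unfolding bij_betw_def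
proof
  show "inj_on (\<lambda>(n, m). n @ [m]) (size_vectors G k \<times> G)" by (auto simp: inj_on_def)
  show "(\<lambda>(n, m). n @ [m]) ` (size_vectors G k \<times> G) = size_vectors G (Suc k)"
  proof (intro set_eqI iffI)
    fix n assume n: "n \<in> size_vectors G (Suc k)"
    then obtain n' m where "n = n' @ [m]" by (cases n rule: rev_cases) (auto simp: size_vectors_def)
    then show "n \<in> (\<lambda>(n, m). n @ [m]) ` (size_vectors G k \<times> G)"
      using n by (auto simp: size_vectors_def intro!: image_eqI[of _ _ "(n', m)"])
  qed (auto simp: size_vectors_def)
qed

lemma size_prob_snoc: "size_prob p (n @ [m]) = size_prob p n * pmf (p (Suc (length n))) m"
  by (simp add: size_prob_def nth_append)

lemma size_prob_nonneg: "0 \<le> size_prob p n"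
  by (simp add: size_prob_def prod_nonneg)

lemma nn_integral_size_vectors_Suc:
  "(\<integral>\<^sup>+n. h n \<partial>count_space (size_vectors G (Suc k))) =
     (\<integral>\<^sup>+n. \<integral>\<^sup>+m. h (n @ [m]) \<partial>count_space G \<partial>count_space (size_vectors G k))"
proof -
  interpret sigma_finite_measure "count_space G"
    by (rule sigma_finite_measure_count_space_countable) simp
  have "(\<integral>\<^sup>+n. h n \<partial>count_space (size_vectors G (Suc k))) =
      (\<integral>\<^sup>+z. h (case z of (n, m) \<Rightarrow> n @ [m]) \<partial>count_space (size_vectors G k \<times> G))"
    by (rule nn_integral_bij_count_space[OF snoc_size_vectors_bij, symmetric])
  also have "count_space (size_vectors G k \<times> G) = count_space (size_vectors G k) \<Otimes>\<^sub>M count_space G"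
    by (rule pair_measure_countable[symmetric]) simp_all
  also have "(\<integral>\<^sup>+z. h (case z of (n, m) \<Rightarrow> n @ [m]) \<partial>(count_space (size_vectors G k) \<Otimes>\<^sub>M count_space G)) =
     (\<integral>\<^sup>+n. \<integral>\<^sup>+m. h (n @ [m]) \<partial>count_space G \<partial>count_space (size_vectors G k))"
    by (subst nn_integral_fst[symmetric]) (simp_all add: pair_measure_countable)
  finally show ?thesis .
qed

section \<open>Sample spaces, densities and continuation probabilities of group sequences\<close>

text \<open>The densities stay inside \<open>h\<close>, so that terms under \<open>f0\<close> and
  under \<open>f1\<close> can be added in one integrand.\<close>

definition path_sum ::
  "'a measure \<Rightarrow> nat set \<Rightarrow> (nat \<Rightarrow> nat pmf) \<Rightarrow> nat \<Rightarrow> (nat list \<Rightarrow> (nat \<Rightarrow> nat \<Rightarrow> 'a) \<Rightarrow> ennreal) \<Rightarrow> ennreal"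
where
  "path_sum M G p k h =
     (\<integral>\<^sup>+n. ennreal (size_prob p n) * (\<integral>\<^sup>+x. h n x \<partial>sample_space M n) \<partial>count_space (size_vectors G k))"

definition group_density :: "('a \<Rightarrow> real) \<Rightarrow> nat \<Rightarrow> (nat \<Rightarrow> 'a) \<Rightarrow> real" where
  "group_density f m y = (\<Prod>j<m. f (y j))"

lemma joint_density_snoc:
  "joint_density f (n @ [m]) (x(length n := y)) = joint_density f n x * group_density f m y"
  by (simp add: joint_density_def group_density_def nth_append)

lemma joint_density_singleton:
  "joint_density f [m] ((\<lambda>_. undefined)(0 := y)) = group_density f m y"
  by (simp add: joint_density_def group_density_def)

lemma sample_space_take:
  "i \<le> length n \<Longrightarrow> sample_space M (take i n) = (\<Pi>\<^sub>M i\<in>{..<i}. \<Pi>\<^sub>M j\<in>{..<n ! i}. M)"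
  unfolding sample_space_def by (intro PiM_cong) auto

lemma sample_space_Nil: "sample_space M [] = count_space {\<lambda>_. undefined}"
  by (simp add: sample_space_def PiM_empty)

text \<open>Both products are written over the sizes of the longer vector, because splitting off one
  coordinate requires a single family of component measures.\<close>

lemma sample_space_snoc:
  shows "sample_space M (n @ [m]) =
      (\<Pi>\<^sub>M i\<in>insert (length n) {..<length n}. \<Pi>\<^sub>M j\<in>{..<(n @ [m]) ! i}. M)"
    and "sample_space M n = (\<Pi>\<^sub>M i\<in>{..<length n}. \<Pi>\<^sub>M j\<in>{..<(n @ [m]) ! i}. M)"
  unfolding sample_space_def by (intro PiM_cong; auto simp: nth_append)+

lemma measurable_restrict_sample_space:
  "i \<le> length n \<Longrightarrow> (\<lambda>x. restrict x {..<i}) \<in> measurable (sample_space M n) (sample_space M (take i n))"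
  unfolding sample_space_take unfolding sample_space_def
  by (rule measurable_restrict_subset) auto

lemma joint_density_measurable:
  assumes "f \<in> borel_measurable M"
  shows "joint_density f n \<in> borel_measurable (sample_space M n)"
proof -
  have "(\<lambda>x. f (x i j)) \<in> borel_measurable (sample_space M n)" if "i < length n" "j < n ! i" for i j
  proof -
    have "(\<lambda>x. x i) \<in> measurable (sample_space M n) (\<Pi>\<^sub>M j\<in>{..<n ! i}. M)"
      unfolding sample_space_def using that by (intro measurable_component_singleton) auto
    moreover have "(\<lambda>y. y j) \<in> measurable (\<Pi>\<^sub>M j\<in>{..<n ! i}. M) M"
      using that by (intro measurable_component_singleton) auto
    ultimately show ?thesis using assms by (auto intro: measurable_compose)
  qed
  then show ?thesis unfolding joint_density_def by (intro borel_measurable_prod) auto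
qed

lemma group_density_measurable:
  assumes "f \<in> borel_measurable M"
  shows "group_density f m \<in> borel_measurable (\<Pi>\<^sub>M j\<in>{..<m}. M)"
  unfolding group_density_def using assms by measurable

lemma sample_space_component:
  "x \<in> space (sample_space M n) \<Longrightarrow> i < length n \<Longrightarrow> j < n ! i \<Longrightarrow> x i j \<in> space M"
  by (auto simp: sample_space_def space_PiM PiE_def Pi_def)

text \<open>Both factors are functions of the first k groups, hence constant when the last group is
  integrated out. No decision is taken before the first group, hence
  \<open>1 \<le> k\<close>.\<close>

lemma continue_prob_Suc:
  assumes "length n = Suc k" "1 \<le> k"
  shows "continue_prob \<psi> n x =
    continue_prob \<psi> (take k n) (restrict x {..<k}) * (1 - \<psi> (take k n) (restrict x {..<k}))"
proof -
  have "{1..<Suc k} = insert k {1..<k}" using assms by auto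
  moreover have "(\<Prod>i\<in>{1..<k}. 1 - \<psi> (take i n) (restrict x {..<i})) =
     (\<Prod>i\<in>{1..<k}. 1 - \<psi> (take i (take k n)) (restrict (restrict x {..<k}) {..<i}))"
    by (intro prod.cong refl) (auto simp: min_def Int_absorb1 restrict_restrict intro!: arg_cong2[of _ _ _ _ \<psi>])
  ultimately show ?thesis using assms by (simp add: continue_prob_def min_def mult.commute)
qed

section \<open>Integration stage by stage\<close>

context group_sequential_model
begin

abbreviation "J \<equiv> path_sum M G p"
abbreviation grp :: "nat \<Rightarrow> (nat \<Rightarrow> 'a) measure" where "grp m \<equiv> \<Pi>\<^sub>M j\<in>{..<m}. M"

lemma sigma_finite_grp: "sigma_finite_measure (grp m)"
proof -
  interpret P: product_sigma_finite "\<lambda>_. M"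
    by (intro product_sigma_finite.intro sigma_finite_measure_axioms)
  show ?thesis by (rule P.sigma_finite) simp
qed

lemma product_sigma_finite_groups: "product_sigma_finite (\<lambda>i. grp (n ! i))"
  by (rule product_sigma_finite.intro) (rule sigma_finite_grp)

lemma nn_integral_sample_space_snoc:
  assumes "h \<in> borel_measurable (sample_space M (n @ [m]))"
  shows "(\<integral>\<^sup>+x. h x \<partial>sample_space M (n @ [m])) = (\<integral>\<^sup>+x. \<integral>\<^sup>+y. h (x(length n := y)) \<partial>grp m \<partial>sample_space M n)"
proof -
  interpret product_sigma_finite "\<lambda>i. grp ((n @ [m]) ! i)" by (rule product_sigma_finite_groups)
  show ?thesis using assms unfolding sample_space_snoc(1) sample_space_snoc(2)[where n = n and m = m] by (subst product_nn_integral_insert) auto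
qed

text \<open>A single group is the empty history extended by one group. This gives the expectations
  in \<open>next_mean\<close> the form of the inner integrals that arise when a group is
  appended.\<close>

lemma expect_singleton:
  assumes F: "F \<in> borel_measurable (sample_space M [m])" and f: "f \<in> borel_measurable M"
  shows "expect M f [m] F = (\<integral>\<^sup>+y. F ((\<lambda>_. undefined)(0 := y)) * ennreal (group_density f m y) \<partial>grp m)"
proof -
  note [measurable] = F joint_density_measurable[OF f]
  show ?thesis
    unfolding expect_def
    using nn_integral_sample_space_snoc[of "\<lambda>x. F x * ennreal (joint_density f [m] x)" "[]" m]
    by (simp add: sample_space_Nil joint_density_singleton nn_integral_count_space_finite del: fun_upd_apply)
qed

lemma nn_integral_group_density:
  assumes f: "f \<in> borel_measurable M" "\<And>x. x \<in> space M \<Longrightarrow> 0 \<le> f x" "(\<integral>\<^sup>+x. ennreal (f x) \<partial>M) = 1"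
  shows "(\<integral>\<^sup>+y. ennreal (group_density f m y) \<partial>grp m) = 1"
proof -
  interpret product_sigma_finite "\<lambda>_. M"
    by (intro product_sigma_finite.intro sigma_finite_measure_axioms)
  have "(\<integral>\<^sup>+y. ennreal (group_density f m y) \<partial>grp m) = (\<integral>\<^sup>+y. (\<Prod>j\<in>{..<m}. ennreal (f (y j))) \<partial>grp m)"
    unfolding group_density_def
    by (intro nn_integral_cong) (auto simp: space_PiM PiE_def Pi_def f intro!: prod_ennreal[symmetric])
  also have "\<dots> = (\<Prod>j\<in>{..<m}. \<integral>\<^sup>+x. ennreal (f x) \<partial>M)"
    using f by (intro product_nn_integral_prod) auto
  finally show ?thesis by (simp add: f)
qed

lemma joint_density_nonneg:
  "x \<in> space (sample_space M n) \<Longrightarrow> 0 \<le> joint_density f0 n x"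
  "x \<in> space (sample_space M n) \<Longrightarrow> 0 \<le> joint_density f1 n x"
  unfolding joint_density_def
  by (auto intro!: prod_nonneg f0_nonneg f1_nonneg dest: sample_space_component)

lemma group_density_nonneg:
  "y \<in> space (grp m) \<Longrightarrow> 0 \<le> group_density f0 m y"
  "y \<in> space (grp m) \<Longrightarrow> 0 \<le> group_density f1 m y"
  unfolding group_density_def
  by (auto intro!: prod_nonneg f0_nonneg f1_nonneg simp: space_PiM PiE_def Pi_def)

lemmas [measurable] = f0_measurable f1_measurable
lemmas jd_measurable [measurable] =
  joint_density_measurable[OF f0_measurable] joint_density_measurable[OF f1_measurable]
  group_density_measurable[OF f0_measurable] group_density_measurable[OF f1_measurable]

lemma lik_ratio_measurable [measurable]: "lik_ratio f0 f1 n \<in> borel_measurable (sample_space M n)"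
  unfolding lik_ratio_def by measurable

text \<open>Only sizes in \<open>G\<close> are constrained, as in \<open>rules\<close>, which says
  nothing about other size vectors.\<close>

definition adapted :: "nat \<Rightarrow> (nat list \<Rightarrow> (nat \<Rightarrow> nat \<Rightarrow> 'a) \<Rightarrow> ennreal) \<Rightarrow> bool" where
  "adapted k h \<longleftrightarrow> (\<forall>n\<in>size_vectors G k. h n \<in> borel_measurable (sample_space M n))"

lemma J_cong:
  assumes "\<And>n x. n \<in> size_vectors G k \<Longrightarrow> x \<in> space (sample_space M n) \<Longrightarrow> h n x = h' n x"
  shows "J k h = J k h'"
  unfolding path_sum_def
  by (intro nn_integral_cong arg_cong2[of _ _ _ _ "(*)"] refl assms) auto

lemma J_add:
  assumes "adapted k h" "adapted k h'"
  shows "J k (\<lambda>n x. h n x + h' n x) = J k h + J k h'"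
proof -
  have "J k (\<lambda>n x. h n x + h' n x) = (\<integral>\<^sup>+n. ennreal (size_prob p n) * (\<integral>\<^sup>+x. h n x \<partial>sample_space M n) +
     ennreal (size_prob p n) * (\<integral>\<^sup>+x. h' n x \<partial>sample_space M n) \<partial>count_space (size_vectors G k))"
    unfolding path_sum_def using assms
    by (intro nn_integral_cong) (simp add: adapted_def nn_integral_add distrib_left)
  then show ?thesis by (simp add: path_sum_def nn_integral_add)
qed

lemma J_cmult:
  assumes "adapted k h"
  shows "J k (\<lambda>n x. a * h n x) = a * J k h"
proof -
  have "J k (\<lambda>n x. a * h n x) = (\<integral>\<^sup>+n. a * (ennreal (size_prob p n) * (\<integral>\<^sup>+x. h n x \<partial>sample_space M n)) \<partial>count_space (size_vectors G k))"
    unfolding path_sum_def using assms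
    by (intro nn_integral_cong) (simp add: adapted_def nn_integral_cmult mult_ac)
  then show ?thesis by (simp add: path_sum_def nn_integral_cmult)
qed

lemma J_mono:
  assumes "\<And>n x. n \<in> size_vectors G k \<Longrightarrow> x \<in> space (sample_space M n) \<Longrightarrow> h n x \<le> h' n x"
  shows "J k h \<le> J k h'"
  unfolding path_sum_def
  by (intro nn_integral_mono mult_left_mono assms) auto

text \<open>Integrands are nonnegative and a size vector of probability 0 contributes nothing. This
  matches the quantifiers over \<open>pos_size_vectors\<close> and almost all data in the optimality
  conditions.\<close>

lemma J_eq_0_iff:
  assumes "adapted k h"
  shows "J k h = 0 \<longleftrightarrow> (\<forall>n\<in>pos_size_vectors G p k. AE x in sample_space M n. h n x = 0)"
proof -
  have *: "ennreal (size_prob p n) = 0 \<longleftrightarrow> \<not> size_prob p n > 0" for n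
    using size_prob_nonneg[of p n] by (auto simp: ennreal_eq_0_iff)
  have "J k h = 0 \<longleftrightarrow> (\<forall>n\<in>size_vectors G k. size_prob p n > 0 \<longrightarrow> (\<integral>\<^sup>+x. h n x \<partial>sample_space M n) = 0)"
    unfolding path_sum_def by (subst nn_integral_0_iff_AE) (auto simp: AE_count_space *)
  also have "\<dots> \<longleftrightarrow> (\<forall>n\<in>pos_size_vectors G p k. AE x in sample_space M n. h n x = 0)"
    using assms by (auto simp: pos_size_vectors_def adapted_def nn_integral_0_iff_AE)
  finally show ?thesis .
qed

text \<open>Tonelli's theorem: the last group is split off, and the sum over its size moves inside
  the integral over the earlier groups. This takes the place of conditioning on the first k
  groups.\<close>

lemma J_Suc:
  assumes "adapted (Suc k) h"
  shows "J (Suc k) h = J k (\<lambda>n x. \<integral>\<^sup>+m. ennreal (pmf (p (Suc k)) m) *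
     (\<integral>\<^sup>+y. h (n @ [m]) (x(k := y)) \<partial>grp m) \<partial>count_space G)"
proof -
  have "J (Suc k) h = (\<integral>\<^sup>+n. \<integral>\<^sup>+m. ennreal (size_prob p (n @ [m])) *
     (\<integral>\<^sup>+x. h (n @ [m]) x \<partial>sample_space M (n @ [m])) \<partial>count_space G \<partial>count_space (size_vectors G k))"
    unfolding path_sum_def by (rule nn_integral_size_vectors_Suc)
  also have "\<dots> = (\<integral>\<^sup>+n. ennreal (size_prob p n) * (\<integral>\<^sup>+x. \<integral>\<^sup>+m. ennreal (pmf (p (Suc k)) m) *
     (\<integral>\<^sup>+y. h (n @ [m]) (x(k := y)) \<partial>grp m) \<partial>count_space G \<partial>sample_space M n) \<partial>count_space (size_vectors G k))"
  proof (rule nn_integral_cong)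
    fix n assume "n \<in> space (count_space (size_vectors G k))"
    then have n: "n \<in> size_vectors G k" "length n = k" by (auto simp: size_vectors_def)
    have h: "h (n @ [m]) \<in> borel_measurable (sample_space M (n @ [m]))" if "m \<in> G" for m
      using assms that n by (auto simp: adapted_def size_vectors_def)
    have inner: "(\<lambda>x. \<integral>\<^sup>+y. h (n @ [m]) (x(k := y)) \<partial>grp m) \<in> borel_measurable (sample_space M n)" if m: "m \<in> G" for m
    proof -
      interpret S: sigma_finite_measure "grp m" by (rule sigma_finite_grp)
      \<comment> \<open>Joint measurability in past data and new group makes the integral over the
        new group measurable in the past.\<close>
      have "(\<lambda>(x, y). x(k := y)) \<in> measurable (sample_space M n \<Otimes>\<^sub>M grp m) (sample_space M (n @ [m]))"
      proof -
        have eqm: "grp m = grp ((n @ [m]) ! k)" unfolding n(2)[symmetric] by simp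
        show ?thesis unfolding sample_space_snoc(1) sample_space_snoc(2)[where n = n and m = m]
          unfolding n(2) by (subst eqm) (rule measurable_add_dim)
      qed
      from measurable_compose[OF this h[OF m]] have "(\<lambda>(x, y). h (n @ [m]) (x(k := y))) \<in> borel_measurable (sample_space M n \<Otimes>\<^sub>M grp m)"
        by (simp add: split_beta')
      then show ?thesis by (rule S.borel_measurable_nn_integral)
    qed
    have "(\<integral>\<^sup>+m. ennreal (size_prob p (n @ [m])) * (\<integral>\<^sup>+x. h (n @ [m]) x \<partial>sample_space M (n @ [m])) \<partial>count_space G) =
       (\<integral>\<^sup>+m. ennreal (size_prob p n) * (\<integral>\<^sup>+x. ennreal (pmf (p (Suc k)) m) * (\<integral>\<^sup>+y. h (n @ [m]) (x(k := y)) \<partial>grp m) \<partial>sample_space M n) \<partial>count_space G)"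
      by (intro nn_integral_cong)
        (simp add: size_prob_snoc n ennreal_mult size_prob_nonneg nn_integral_sample_space_snoc[OF h] nn_integral_cmult[OF inner] mult.assoc)
    also have "\<dots> = ennreal (size_prob p n) * (\<integral>\<^sup>+m. \<integral>\<^sup>+x. ennreal (pmf (p (Suc k)) m) * (\<integral>\<^sup>+y. h (n @ [m]) (x(k := y)) \<partial>grp m) \<partial>sample_space M n \<partial>count_space G)"
      by (simp add: nn_integral_cmult)
    also have "(\<integral>\<^sup>+m. \<integral>\<^sup>+x. ennreal (pmf (p (Suc k)) m) * (\<integral>\<^sup>+y. h (n @ [m]) (x(k := y)) \<partial>grp m) \<partial>sample_space M n \<partial>count_space G) =
      (\<integral>\<^sup>+x. \<integral>\<^sup>+m. ennreal (pmf (p (Suc k)) m) * (\<integral>\<^sup>+y. h (n @ [m]) (x(k := y)) \<partial>grp m) \<partial>count_space G \<partial>sample_space M n)"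
      by (rule nn_integral_count_space_nn_integral[symmetric]) (auto intro!: borel_measurable_times_ennreal inner)
    finally show "(\<integral>\<^sup>+m. ennreal (size_prob p (n @ [m])) * (\<integral>\<^sup>+x. h (n @ [m]) x \<partial>sample_space M (n @ [m])) \<partial>count_space G) = ennreal (size_prob p n) * (\<integral>\<^sup>+x. \<integral>\<^sup>+m. ennreal (pmf (p (Suc k)) m) *
     (\<integral>\<^sup>+y. h (n @ [m]) (x(k := y)) \<partial>grp m) \<partial>count_space G \<partial>sample_space M n)" .
  qed
  finally show ?thesis by (simp add: path_sum_def)
qed

section \<open>The step of the backward recursion\<close>

lemma next_mean_measurable:
  assumes [measurable]: "W \<in> borel_measurable borel"
  shows "next_mean M f0 f1 G p k W \<in> borel_measurable borel"
proof -
  interpret S: sigma_finite_measure "sample_space M [m]" for m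
  proof -
    interpret P: product_sigma_finite "\<lambda>i. grp ([m] ! i)" by (rule product_sigma_finite_groups)
    show "sigma_finite_measure (sample_space M [m])"
      unfolding sample_space_def by (rule P.sigma_finite) simp
  qed
  show ?thesis
    unfolding next_mean_def infsum_eq_nn_integral_count_space expect_def
    by (intro borel_measurable_nn_integral_count_space_nat borel_measurable_times_ennreal
      S.borel_measurable_nn_integral) measurable
qed

text \<open>Each stage integrates the next one over a parameter-dependent argument, so measurability
  is handed backwards from stage N; the induction is on the number of stages left.\<close>

lemma V_measurable [measurable]: "V M f0 f1 G p c l0 l1 N k \<in> borel_measurable borel"
proof (induction "N - k" arbitrary: k)
  case 0
  then show ?case by (subst V.simps) (simp add: stop_loss_def[abs_def])
next
  case (Suc d)
  then have *: "V M f0 f1 G p c l0 l1 N (k + 1) \<in> borel_measurable borel" by simp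
  show ?case
    by (subst V.simps) (use next_mean_measurable[OF *] in \<open>simp add: stop_loss_def[abs_def]\<close>)
qed

lemma next_mean_eq:
  assumes [measurable]: "W \<in> borel_measurable borel"
  shows "next_mean M f0 f1 G p k W z = (\<integral>\<^sup>+m. ennreal (pmf (p k) m) *
    (\<integral>\<^sup>+y. W (z * lik_ratio f0 f1 [m] ((\<lambda>_. undefined)(0 := y))) * ennreal (group_density f0 m y) \<partial>grp m) \<partial>count_space G)"
  unfolding next_mean_def infsum_eq_nn_integral_count_space
  by (intro nn_integral_cong arg_cong2[of _ _ _ _ "(*)"] refl expect_singleton) measurable

lemma lik_ratio_snoc:
  assumes "x \<in> space (sample_space M n)" "y \<in> space (grp m)"
    and "joint_density f0 n x > 0" "group_density f0 m y > 0"
  shows "lik_ratio f0 f1 (n @ [m]) (x(length n := y)) =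
    lik_ratio f0 f1 n x * lik_ratio f0 f1 [m] ((\<lambda>_. undefined)(0 := y))"
proof -
  show ?thesis
    using assms joint_density_nonneg(2)[OF assms(1)] group_density_nonneg(2)[OF assms(2)]
    by (simp add: lik_ratio_def joint_density_snoc joint_density_singleton ennreal_mult[symmetric] del: fun_upd_apply)
qed

lemma nn_integral_size_pmf: "1 \<le> k \<Longrightarrow> (\<integral>\<^sup>+m. ennreal (pmf (p k) m) \<partial>count_space G) = 1"
  using sizes[of k] by (simp add: nn_integral_pmf measure_pmf.emeasure_eq_1_AE AE_measure_pmf_iff subset_iff)

lemma group_measurable_snoc:
  assumes "x \<in> space (sample_space M n)"
  shows "(\<lambda>y. x(length n := y)) \<in> measurable (grp m) (sample_space M (n @ [m]))"
proof -
  show ?thesis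
    using assms unfolding sample_space_snoc(1) sample_space_snoc(2)[where n = n and m = m]
    by (intro measurable_fun_upd[where J = "{..<length n}"]) auto
qed

definition cost :: "nat list \<Rightarrow> ennreal" where
  "cost n = ennreal (\<Sum>i<length n. c (n ! i))"

lemma cost_snoc:
  assumes "n \<in> size_vectors G k" "m \<in> G"
  shows "cost (n @ [m]) = cost n + ennreal (c m)"
proof -
  have "0 \<le> (\<Sum>i<length n. c (n ! i))"
    using assms by (intro sum_nonneg) (auto simp: size_vectors_def intro!: less_imp_le cost_pos)
  moreover have "0 \<le> c m" using assms cost_pos by (simp add: less_imp_le)
  ultimately show ?thesis by (simp add: cost_def nth_append)
qed

lemma adapted_restrict:
  assumes "adapted k w"
  shows "adapted (Suc k) (\<lambda>n x. w (take k n) (restrict x {..<k}))"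
  unfolding adapted_def
proof
  fix n assume n: "n \<in> size_vectors G (Suc k)"
  then have "take k n \<in> size_vectors G k" by (auto simp: size_vectors_def dest: in_set_takeD)
  then have "w (take k n) \<in> borel_measurable (sample_space M (take k n))"
    using assms by (simp add: adapted_def)
  moreover have "k \<le> length n" using n by (simp add: size_vectors_def)
  ultimately show "(\<lambda>x. w (take k n) (restrict x {..<k})) \<in> borel_measurable (sample_space M n)"
    by (intro measurable_compose[OF measurable_restrict_sample_space])
qed

text \<open>\<open>w\<close> and the past cost do not depend on group k + 1, the ratio is multiplied
  by that of the new group, and the new density integrates to 1. \<open>W\<close> is general because
  the step serves both \<open>V\<close> and the constant majorant in
  \<open>total_bound_1_finite\<close>.\<close>

lemma J_step:
  assumes W [measurable]: "W \<in> borel_measurable borel" and w: "adapted k w"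
  shows "J (Suc k) (\<lambda>n x. w (take k n) (restrict x {..<k}) *
      ((cost n + W (lik_ratio f0 f1 n x)) * ennreal (joint_density f0 n x))) =
    J k (\<lambda>n x. w n x * ((cost n + (mean_group_cost G p c (Suc k) +
      next_mean M f0 f1 G p (Suc k) W (lik_ratio f0 f1 n x))) * ennreal (joint_density f0 n x)))"
    (is "J (Suc k) ?h = J k ?r")
proof -
  have adapted: "adapted (Suc k) ?h"
    using adapted_restrict[OF w] unfolding adapted_def by (intro ballI borel_measurable_times_ennreal) auto
  show ?thesis unfolding J_Suc[OF adapted]
  proof (rule J_cong)
    fix n x assume n: "n \<in> size_vectors G k" and x: "x \<in> space (sample_space M n)"
    have len [simp]: "length n = k" using n by (simp add: size_vectors_def)
    have restr: "restrict (x(k := y)) {..<k} = x" for y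
      using x by (auto simp: sample_space_def space_PiM PiE_def extensional_def restrict_def)
    \<comment> \<open>\<open>A\<close> collects the factors that are constant under the integral
      over the new group.\<close>
    define A where "A = w n x * ennreal (joint_density f0 n x)"
    define I where "I m = (\<integral>\<^sup>+y. W (lik_ratio f0 f1 n x * lik_ratio f0 f1 [m] ((\<lambda>_. undefined)(0 := y))) *
      ennreal (group_density f0 m y) \<partial>grp m)" for m
    have emp: "(\<lambda>_. undefined) \<in> space (sample_space M [])"
      by (simp add: sample_space_Nil)
    have meas [measurable]: "(\<lambda>y. lik_ratio f0 f1 [m] ((\<lambda>_. undefined)(0 := y))) \<in> borel_measurable (grp m)" for m
      using measurable_compose[OF group_measurable_snoc[OF emp] lik_ratio_measurable, of m] by simp
    have inner: "(\<integral>\<^sup>+y. ?h (n @ [m]) (x(k := y)) \<partial>grp m) = A * (cost n + ennreal (c m) + I m)"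
      if m: "m \<in> G" for m
    proof -
      have "(\<integral>\<^sup>+y. ?h (n @ [m]) (x(k := y)) \<partial>grp m) =
        (\<integral>\<^sup>+y. A * ((cost n + ennreal (c m)) * ennreal (group_density f0 m y) +
          W (lik_ratio f0 f1 n x * lik_ratio f0 f1 [m] ((\<lambda>_. undefined)(0 := y))) * ennreal (group_density f0 m y)) \<partial>grp m)"
      proof (rule nn_integral_cong)
        fix y assume y: "y \<in> space (grp m)"
        have jd: "ennreal (joint_density f0 (n @ [m]) (x(k := y))) =
            ennreal (joint_density f0 n x) * ennreal (group_density f0 m y)"
          using joint_density_snoc[of f0 n m x y] joint_density_nonneg(1)[OF x] group_density_nonneg(1)[OF y]
          by (simp add: ennreal_mult)
        show "?h (n @ [m]) (x(k := y)) = A * ((cost n + ennreal (c m)) * ennreal (group_density f0 m y) +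
          W (lik_ratio f0 f1 n x * lik_ratio f0 f1 [m] ((\<lambda>_. undefined)(0 := y))) * ennreal (group_density f0 m y))"
        proof (cases "joint_density f0 n x > 0 \<and> group_density f0 m y > 0")
          case True
          then show ?thesis
            using lik_ratio_snoc[OF x y]
            by (simp add: jd restr A_def cost_snoc[OF n m] algebra_simps del: fun_upd_apply)
        next
          \<comment> \<open>A vanishing \<open>f0\<close> density makes both sides 0 whatever the
            ratio is, since 0 times infinity is 0 in \<open>ennreal\<close>.\<close>
          case False
          then show ?thesis
            using joint_density_nonneg(1)[OF x] group_density_nonneg(1)[OF y]
            by (auto simp: jd restr A_def ennreal_neg simp del: fun_upd_apply)
        qed
      qed
      also have "\<dots> = A * ((cost n + ennreal (c m)) * (\<integral>\<^sup>+y. ennreal (group_density f0 m y) \<partial>grp m) + I m)"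
        unfolding I_def by (simp add: nn_integral_cmult nn_integral_add del: fun_upd_apply)
      also have "(\<integral>\<^sup>+y. ennreal (group_density f0 m y) \<partial>grp m) = 1"
        by (rule nn_integral_group_density) (auto simp: f0_measurable f0_nonneg f0_density)
      finally show ?thesis by (simp only: mult_1_right)
    qed
    have "(\<integral>\<^sup>+m. ennreal (pmf (p (Suc k)) m) * (\<integral>\<^sup>+y. ?h (n @ [m]) (x(k := y)) \<partial>grp m) \<partial>count_space G) =
      (\<integral>\<^sup>+m. ennreal (pmf (p (Suc k)) m) * (A * (cost n + ennreal (c m) + I m)) \<partial>count_space G)"
      by (intro nn_integral_cong arg_cong2[of _ _ _ _ "(*)"] refl inner) simp
    \<comment> \<open>The size probabilities sum to 1, which keeps \<open>cost n\<close>; weighted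
      by \<open>c m\<close> they give the mean group cost.\<close>
    also have "\<dots> = (\<integral>\<^sup>+m. A * (cost n * ennreal (pmf (p (Suc k)) m) + (ennreal (pmf (p (Suc k)) m * c m) +
         ennreal (pmf (p (Suc k)) m) * I m)) \<partial>count_space G)"
      by (intro nn_integral_cong) (simp add: ennreal_mult cost_pos less_imp_le algebra_simps)
    also have "\<dots> = A * (cost n + (mean_group_cost G p c (Suc k) + next_mean M f0 f1 G p (Suc k) W (lik_ratio f0 f1 n x)))"
      by (simp add: nn_integral_cmult nn_integral_add nn_integral_size_pmf mean_group_cost_def
        infsum_eq_nn_integral_count_space next_mean_eq[OF W] I_def del: fun_upd_apply)
    finally show "(\<integral>\<^sup>+m. ennreal (pmf (p (Suc k)) m) * (\<integral>\<^sup>+y. ?h (n @ [m]) (x(k := y)) \<partial>grp m) \<partial>count_space G) = ?r n x"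
      by (simp add: A_def mult_ac)
  qed
qed

section \<open>Bounds and measurability of rules; effect of truncation\<close>

lemma take_size_vectors: "n \<in> size_vectors G k \<Longrightarrow> i \<le> k \<Longrightarrow> take i n \<in> size_vectors G i"
  by (auto simp: size_vectors_def dest: in_set_takeD)

lemma restrict_sample_space:
  "x \<in> space (sample_space M n) \<Longrightarrow> i \<le> length n \<Longrightarrow> restrict x {..<i} \<in> space (sample_space M (take i n))"
  using measurable_space[OF measurable_restrict_sample_space] by blast

lemma rules_bounds:
  assumes "\<psi> \<in> rules M G" "n \<in> size_vectors G k" "1 \<le> k" "x \<in> space (sample_space M n)"
  shows "0 \<le> \<psi> n x" "\<psi> n x \<le> 1"
  using assms by (auto simp: rules_def)

lemma rules_measurable:
  assumes "\<psi> \<in> rules M G" "n \<in> size_vectors G k" "1 \<le> k"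
  shows "\<psi> n \<in> borel_measurable (sample_space M n)"
  using assms by (auto simp: rules_def)

lemma continue_prob_bounds:
  assumes "\<psi> \<in> rules M G" "n \<in> size_vectors G k" "x \<in> space (sample_space M n)"
  shows "0 \<le> continue_prob \<psi> n x" "continue_prob \<psi> n x \<le> 1"
proof -
  have "0 \<le> \<psi> (take i n) (restrict x {..<i}) \<and> \<psi> (take i n) (restrict x {..<i}) \<le> 1"
    if "i \<in> {1..<length n}" for i
  proof -
    have i: "i \<le> length n" "1 \<le> i" "i \<le> k" using that assms by (auto simp: size_vectors_def)
    show ?thesis
      using rules_bounds[OF assms(1) take_size_vectors[OF assms(2) i(3)] i(2) restrict_sample_space[OF assms(3) i(1)]]
      by simp
  qed
  then show "0 \<le> continue_prob \<psi> n x" "continue_prob \<psi> n x \<le> 1"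
    unfolding continue_prob_def by (auto intro!: prod_nonneg prod_le_1)
qed

lemma continue_prob_measurable:
  assumes "\<psi> \<in> rules M G" "n \<in> size_vectors G k"
  shows "continue_prob \<psi> n \<in> borel_measurable (sample_space M n)"
  unfolding continue_prob_def
proof (intro borel_measurable_prod borel_measurable_diff borel_measurable_const)
  fix i assume "i \<in> {1..<length n}"
  then have i: "i \<le> length n" "1 \<le> i" "i \<le> k" using assms by (auto simp: size_vectors_def)
  show "(\<lambda>x. \<psi> (take i n) (restrict x {..<i})) \<in> borel_measurable (sample_space M n)"
    by (rule measurable_compose[OF measurable_restrict_sample_space[OF i(1)]
      rules_measurable[OF assms(1) take_size_vectors[OF assms(2) i(3)] i(2)]])
qed

lemma truncated_rules_in_rules: "\<psi> \<in> truncated_rules M G N \<Longrightarrow> \<psi> \<in> rules M G"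
  by (simp add: truncated_rules_def)

text \<open>The truncation product for the first N groups has a zero factor, and this factor
  reappears in the longer product because its index is below k.\<close>

lemma continue_prob_after_truncation:
  assumes "\<psi> \<in> truncated_rules M G N" "n \<in> size_vectors G k" "x \<in> space (sample_space M n)" "N < k"
  shows "continue_prob \<psi> n x = 0"
proof -
  have k: "length n = k" using assms by (simp add: size_vectors_def)
  have "take N n \<in> size_vectors G N" "restrict x {..<N} \<in> space (sample_space M (take N n))"
    using assms k by (auto intro: take_size_vectors restrict_sample_space)
  then have "(\<Prod>i\<in>{1..N}. 1 - \<psi> (take i (take N n)) (restrict (restrict x {..<N}) {..<i})) = 0"
    using assms(1) unfolding truncated_rules_def by blast
  then have "\<exists>i\<in>{1..N}. 1 - \<psi> (take i (take N n)) (restrict (restrict x {..<N}) {..<i}) = 0"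
    by (simp only: prod_zero_iff[OF finite_atLeastAtMost])
  then obtain i where i: "1 \<le> i" "i \<le> N" "1 - \<psi> (take i (take N n)) (restrict (restrict x {..<N}) {..<i}) = 0"
    by (meson atLeastAtMost_iff)
  moreover have "{..<N} \<inter> {..<i} = {..<i}" using i by auto
  ultimately have "\<psi> (take i n) (restrict x {..<i}) = 1" by (simp add: min_def)
  then show ?thesis
    using i assms(4) k by (auto simp: continue_prob_def intro!: prod_zero bexI[of _ i])
qed

text \<open>At stage N the truncation product is \<open>continue_prob\<close> times the probability
  of not stopping, so all mass that is left stops there.\<close>

lemma stop_at_truncation:
  assumes "\<psi> \<in> truncated_rules M G N" "n \<in> size_vectors G N" "x \<in> space (sample_space M n)" "1 \<le> N"
  shows "stop_prob \<psi> n x = continue_prob \<psi> n x"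
proof -
  have N: "length n = N" using assms by (simp add: size_vectors_def)
  have "restrict x {..<N} = x"
    using assms(3) N by (auto simp: sample_space_def space_PiM PiE_def extensional_def restrict_def)
  moreover have "{1..N} = insert N {1..<N}" using assms by auto
  moreover have "(\<Prod>i\<in>{1..N}. 1 - \<psi> (take i n) (restrict x {..<i})) = 0"
    using assms by (simp add: truncated_rules_def)
  ultimately have "(1 - \<psi> n x) * continue_prob \<psi> n x = 0"
    using N by (simp add: continue_prob_def)
  then show ?thesis by (simp add: stop_prob_def algebra_simps)
qed

lemma infsum_stages:
  assumes "\<And>k n x. N < k \<Longrightarrow> n \<in> size_vectors G k \<Longrightarrow> x \<in> space (sample_space M n) \<Longrightarrow> F n x = 0"
  shows "(\<Sum>\<^sub>\<infinity>k\<in>{1..}. \<Sum>\<^sub>\<infinity>n\<in>size_vectors G k. ennreal (size_prob p n) * (\<integral>\<^sup>+x. F n x \<partial>sample_space M n)) =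
    (\<Sum>k=1..N. J k F)"
proof -
  have zero: "J k F = 0" if "N < k" for k
  proof -
    have "J k F = J k (\<lambda>_ _. 0)" using assms that by (intro J_cong)
    then show ?thesis by (simp add: path_sum_def)
  qed
  have "(\<Sum>\<^sub>\<infinity>k\<in>{1..}. \<Sum>\<^sub>\<infinity>n\<in>size_vectors G k. ennreal (size_prob p n) * (\<integral>\<^sup>+x. F n x \<partial>sample_space M n)) =
    (\<Sum>\<^sub>\<infinity>k\<in>{1..}. J k F)"
    by (simp add: path_sum_def infsum_eq_nn_integral_count_space)
  also have "\<dots> = (\<Sum>\<^sub>\<infinity>k\<in>{1..N}. J k F)"
    by (rule infsum_cong_neutral) (auto simp: zero)
  finally show ?thesis by simp
qed

section \<open>Telescoping the value of the stopping problem\<close>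

context
  fixes l0 l1 :: real and N :: nat
  assumes l0: "0 < l0" and l1: "0 < l1" and N: "1 \<le> N"
begin

abbreviation "lr \<equiv> lik_ratio f0 f1"
abbreviation "d0 n x \<equiv> ennreal (joint_density f0 n x)"
abbreviation "g \<equiv> stop_loss l0 l1"
abbreviation "v \<equiv> V M f0 f1 G p c l0 l1 N"
abbreviation "q k z \<equiv> mean_group_cost G p c (k + 1) + V_bar M f0 f1 G p c l0 l1 N (k + 1) z"

lemma stop_loss_measurable [measurable]: "g \<in> borel_measurable borel"
  unfolding stop_loss_def[abs_def] by measurable

lemma q_measurable [measurable]: "q k \<in> borel_measurable borel"
  using next_mean_measurable[OF V_measurable] by (simp add: V_bar_def[abs_def])

lemma V_last: "v N = g"
  by (subst V.simps) simp

lemma V_before: "k < N \<Longrightarrow> v k z = min (g z) (q k z)"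
  by (subst V.simps) (simp add: V_bar_def)

lemma V_le: "v k z \<le> ennreal l0"
  by (subst V.simps) (auto simp: stop_loss_def min.coboundedI1)

text \<open>The telescoping quantity: cost so far plus optimal future loss, over the paths not
  stopped before stage k.\<close>

definition total_bound :: "'a rule \<Rightarrow> nat \<Rightarrow> ennreal" where
  "total_bound \<psi> k = J k (\<lambda>n x. ennreal (continue_prob \<psi> n x) * ((cost n + v k (lr n x)) * d0 n x))"

text \<open>Stopped mass is charged the terminal loss of the best decision; the actual decision rule
  enters only through \<open>decision_excess\<close>.\<close>

definition stop_total :: "'a rule \<Rightarrow> nat list \<Rightarrow> (nat \<Rightarrow> nat \<Rightarrow> 'a) \<Rightarrow> ennreal" where
  "stop_total \<psi> n x = ennreal (stop_prob \<psi> n x) * ((cost n + g (lr n x)) * d0 n x)"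

text \<open>
  Losses against the optimal action, per unit of \<open>M\<close>: \<open>stop_excess\<close> vanishes where the stopping rule
  attains the minimum in the recursion for \<open>V\<close>, \<open>decision_excess\<close> where the decision rule attains
  \<open>min (l0 * f0) (l1 * f1)\<close>.
\<close>

definition stop_excess :: "'a rule \<Rightarrow> nat \<Rightarrow> nat list \<Rightarrow> (nat \<Rightarrow> nat \<Rightarrow> 'a) \<Rightarrow> ennreal" where
  "stop_excess \<psi> k n x = ennreal (continue_prob \<psi> n x) *
     ((ennreal (\<psi> n x) * (g (lr n x) - v k (lr n x)) +
       ennreal (1 - \<psi> n x) * (q k (lr n x) - v k (lr n x))) * d0 n x)"

definition decision_excess :: "'a rule \<Rightarrow> 'a rule \<Rightarrow> nat list \<Rightarrow> (nat \<Rightarrow> nat \<Rightarrow> 'a) \<Rightarrow> ennreal" where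
  "decision_excess \<psi> \<phi> n x = ennreal (stop_prob \<psi> n x *
     (l0 * joint_density f0 n x * \<phi> n x + l1 * joint_density f1 n x * (1 - \<phi> n x) -
      min (l0 * joint_density f0 n x) (l1 * joint_density f1 n x)))"

lemma adapted_rule_functions:
  assumes "\<psi> \<in> rules M G" "1 \<le> k"
  shows "adapted k (stop_total \<psi>)"
    "adapted k (\<lambda>n x. ennreal (continue_prob \<psi> n x) * ((cost n + v k (lr n x)) * d0 n x))"
    "adapted k (\<lambda>n x. ennreal (continue_prob \<psi> n x) * ennreal (1 - \<psi> n x))"
    "adapted k (\<lambda>n x. ennreal (continue_prob \<psi> n x) * ennreal (1 - \<psi> n x) * ((cost n + q k (lr n x)) * d0 n x))"
    "adapted k (stop_excess \<psi> k)"
proof -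
  have [measurable]: "continue_prob \<psi> n \<in> borel_measurable (sample_space M n)"
    "\<psi> n \<in> borel_measurable (sample_space M n)" if "n \<in> size_vectors G k" for n
    using rules_measurable continue_prob_measurable assms that by blast+
  show "adapted k (stop_total \<psi>)"
    "adapted k (\<lambda>n x. ennreal (continue_prob \<psi> n x) * ((cost n + v k (lr n x)) * d0 n x))"
    "adapted k (\<lambda>n x. ennreal (continue_prob \<psi> n x) * ennreal (1 - \<psi> n x))"
    "adapted k (\<lambda>n x. ennreal (continue_prob \<psi> n x) * ennreal (1 - \<psi> n x) * ((cost n + q k (lr n x)) * d0 n x))"
    "adapted k (stop_excess \<psi> k)"
    unfolding adapted_def stop_total_def[abs_def] stop_prob_def stop_excess_def[abs_def]
    by (intro ballI; measurable)+
qed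

lemma total_bound_Suc:
  assumes "\<psi> \<in> rules M G" "1 \<le> k"
  shows "total_bound \<psi> (Suc k) = J k (\<lambda>n x. ennreal (continue_prob \<psi> n x) * ennreal (1 - \<psi> n x) *
    ((cost n + q k (lr n x)) * d0 n x))"
proof -
  have "total_bound \<psi> (Suc k) = J (Suc k) (\<lambda>n x. ennreal (continue_prob \<psi> (take k n) (restrict x {..<k})) *
      ennreal (1 - \<psi> (take k n) (restrict x {..<k})) * ((cost n + v (Suc k) (lr n x)) * d0 n x))"
    unfolding total_bound_def
  proof (rule J_cong)
    fix n x assume n: "n \<in> size_vectors G (Suc k)" and x: "x \<in> space (sample_space M n)"
    have len: "length n = Suc k" using n by (simp add: size_vectors_def)
    have t: "take k n \<in> size_vectors G k" "restrict x {..<k} \<in> space (sample_space M (take k n))"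
      using n x len by (auto intro: take_size_vectors restrict_sample_space)
    show "ennreal (continue_prob \<psi> n x) * ((cost n + v (Suc k) (lr n x)) * d0 n x) =
      ennreal (continue_prob \<psi> (take k n) (restrict x {..<k})) *
      ennreal (1 - \<psi> (take k n) (restrict x {..<k})) * ((cost n + v (Suc k) (lr n x)) * d0 n x)"
      using continue_prob_bounds[OF assms(1) t] rules_bounds[OF assms(1) t(1) assms(2) t(2)]
      unfolding continue_prob_Suc[OF len assms(2)] by (simp add: ennreal_mult)
  qed
  also have "\<dots> = J k (\<lambda>n x. ennreal (continue_prob \<psi> n x) * ennreal (1 - \<psi> n x) *
    ((cost n + q k (lr n x)) * d0 n x))"
    using J_step[OF V_measurable adapted_rule_functions(3)[OF assms]] by (simp add: V_bar_def)
  finally show ?thesis .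
qed

text \<open>A fraction \<psi> of the mass stops and pays \<open>g\<close>, the rest continues and
  pays \<open>q\<close>. Each payment is \<open>v k\<close>, the minimum of the two, plus its own
  excess.\<close>

lemma stage_identity:
  assumes "\<psi> \<in> rules M G" "1 \<le> k" "k < N"
  shows "J k (stop_total \<psi>) + total_bound \<psi> (Suc k) = total_bound \<psi> k + J k (stop_excess \<psi> k)"
proof -
  note adapted = adapted_rule_functions[OF assms(1,2)]
  show ?thesis
    unfolding total_bound_Suc[OF assms(1,2)] unfolding total_bound_def
    unfolding J_add[OF adapted(1,4), symmetric] J_add[OF adapted(2,5), symmetric]
  proof (rule J_cong)
    fix n x assume n: "n \<in> size_vectors G k" and x: "x \<in> space (sample_space M n)"
    note bounds = continue_prob_bounds[OF assms(1) n x] rules_bounds[OF assms(1) n assms(2) x]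
    define e1 e2 where "e1 = g (lr n x) - v k (lr n x)" and "e2 = q k (lr n x) - v k (lr n x)"
    have "v k (lr n x) \<le> g (lr n x)" "v k (lr n x) \<le> q k (lr n x)"
      using assms(3) by (simp_all add: V_before)
    \<comment> \<open>Truncated subtraction is harmless here, since \<open>v k\<close> lies below
      both \<open>g\<close> and \<open>q k\<close>.\<close>
    then have e: "g (lr n x) = v k (lr n x) + e1" "q k (lr n x) = v k (lr n x) + e2"
      unfolding e1_def e2_def by (simp_all add: add_diff_inverse_ennreal)
    have "ennreal (\<psi> n x) + ennreal (1 - \<psi> n x) = 1"
      using bounds by (simp add: ennreal_plus[symmetric] del: ennreal_plus)
    then have split: "X = ennreal (\<psi> n x) * X + ennreal (1 - \<psi> n x) * X" for X
      by (metis distrib_right mult_1)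
    have "stop_total \<psi> n x + ennreal (continue_prob \<psi> n x) * ennreal (1 - \<psi> n x) * ((cost n + q k (lr n x)) * d0 n x) =
      (ennreal (\<psi> n x) * (ennreal (continue_prob \<psi> n x) * ((cost n + v k (lr n x)) * d0 n x)) +
       ennreal (1 - \<psi> n x) * (ennreal (continue_prob \<psi> n x) * ((cost n + v k (lr n x)) * d0 n x))) + stop_excess \<psi> k n x"
      unfolding stop_total_def stop_excess_def e1_def[symmetric] e2_def[symmetric] stop_prob_def
      unfolding e using bounds by (simp add: ennreal_mult distrib_left distrib_right ac_simps)
    then show "stop_total \<psi> n x + ennreal (continue_prob \<psi> n x) * ennreal (1 - \<psi> n x) * ((cost n + q k (lr n x)) * d0 n x) =
      ennreal (continue_prob \<psi> n x) * ((cost n + v k (lr n x)) * d0 n x) + stop_excess \<psi> k n x"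
      unfolding split[symmetric] .
  qed
qed

lemma last_stage_identity:
  assumes "\<psi> \<in> truncated_rules M G N"
  shows "J N (stop_total \<psi>) = total_bound \<psi> N"
  unfolding total_bound_def
  using stop_at_truncation[OF assms _ _ N] by (intro J_cong) (simp add: stop_total_def V_last)

lemma sum_stop_total:
  assumes "\<psi> \<in> truncated_rules M G N"
  shows "(\<Sum>k=1..N. J k (stop_total \<psi>)) = total_bound \<psi> 1 + (\<Sum>k\<in>{1..<N}. J k (stop_excess \<psi> k))"
proof -
  \<comment> \<open>Mass not stopped before stage j is accounted for by
    \<open>total_bound \<psi> j\<close>; at j = N this remainder is exactly the last stage.\<close>
  have partial: "(\<Sum>k\<in>{1..<j}. J k (stop_total \<psi>)) + total_bound \<psi> j =
    total_bound \<psi> 1 + (\<Sum>k\<in>{1..<j}. J k (stop_excess \<psi> k))" if "1 \<le> j" "j \<le> N" for j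
    using that
  proof (induction j rule: dec_induct)
    case (step j)
    then have "(\<Sum>k\<in>{1..<Suc j}. J k (stop_total \<psi>)) + total_bound \<psi> (Suc j) =
        (\<Sum>k\<in>{1..<j}. J k (stop_total \<psi>)) + (J j (stop_total \<psi>) + total_bound \<psi> (Suc j))"
      by (simp add: add.assoc)
    also have "\<dots> = (\<Sum>k\<in>{1..<j}. J k (stop_total \<psi>)) + total_bound \<psi> j + J j (stop_excess \<psi> j)"
      using step by (simp add: stage_identity[OF truncated_rules_in_rules[OF assms]] add.assoc)
    also have "\<dots> = total_bound \<psi> 1 + (\<Sum>k\<in>{1..<j}. J k (stop_excess \<psi> k)) + J j (stop_excess \<psi> j)"
      using step by simp
    finally show ?case using step by (simp add: add.assoc)
  qed simp
  have "{1..N} = insert N {1..<N}" using N by auto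
  then show ?thesis using partial[of N] N last_stage_identity[OF assms] by (simp add: add.commute)
qed

text \<open>The continuation probability of a single group is an empty product, so no rule can
  influence this value: it is the common lower bound for all tests.\<close>

lemma total_bound_1: "total_bound \<psi> 1 = total_bound \<psi>' 1"
  unfolding total_bound_def by (intro J_cong) (simp add: continue_prob_def size_vectors_def)

text \<open>Stopping after the first group and always rejecting costs at most the first mean group
  cost plus l0.\<close>

lemma total_bound_1_finite: "total_bound \<psi> 1 < \<top>"
proof -
  have "total_bound \<psi> 1 \<le> J (Suc 0) (\<lambda>n x. 1 * ((cost n + ennreal l0) * d0 n x))"
    unfolding total_bound_def
    by (auto intro!: J_mono mult_right_mono add_mono V_le simp: continue_prob_def size_vectors_def)
  \<comment> \<open>The recursion step from the empty history, with the constant majorant l0 in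
    place of \<open>V\<close>.\<close>
  also have "\<dots> = J 0 (\<lambda>n x. 1 * ((cost n + (mean_group_cost G p c (Suc 0) +
      next_mean M f0 f1 G p (Suc 0) (\<lambda>_. ennreal l0) (lr n x))) * d0 n x))"
    by (rule J_step) (auto simp: adapted_def)
  also have "\<dots> = mean_group_cost G p c 1 + ennreal l0"
  proof -
    have sv: "size_vectors G 0 = {[]}" by (auto simp: size_vectors_def)
    have "(\<integral>\<^sup>+y. ennreal (group_density f0 m y) \<partial>grp m) = 1" for m
      by (rule nn_integral_group_density) (auto simp: f0_measurable f0_nonneg f0_density)
    then have "next_mean M f0 f1 G p (Suc 0) (\<lambda>_. ennreal l0) z = ennreal l0" for z
      by (simp add: next_mean_eq nn_integral_cmult nn_integral_multc nn_integral_size_pmf del: fun_upd_apply)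
    then show ?thesis
      by (simp add: path_sum_def sv sample_space_Nil nn_integral_count_space_finite size_prob_def cost_def joint_density_def)
  qed
  also have "\<dots> < \<top>" using mean_cost[of 1] by (simp add: mean_group_cost_def)
  finally show ?thesis .
qed

section \<open>Decision losses and the weighted sum\<close>

lemma stop_prob_nonneg:
  assumes "\<psi> \<in> rules M G" "n \<in> size_vectors G k" "1 \<le> k" "x \<in> space (sample_space M n)"
  shows "0 \<le> stop_prob \<psi> n x"
  using continue_prob_bounds[OF assms(1,2,4)] rules_bounds[OF assms] by (simp add: stop_prob_def)

lemma stop_prob_measurable:
  assumes "\<psi> \<in> rules M G" "n \<in> size_vectors G k" "1 \<le> k"
  shows "stop_prob \<psi> n \<in> borel_measurable (sample_space M n)"
  unfolding stop_prob_def
  using continue_prob_measurable[OF assms(1,2)] rules_measurable[OF assms] by measurable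

text \<open>Turns a loss under both densities into a P0-integrand. Where \<open>f0\<close> is 0 both
  sides are 0, even if the ratio is infinite, as \<open>g\<close> stays bounded by l0.\<close>

lemma stop_loss_joint:
  assumes "x \<in> space (sample_space M n)"
  shows "g (lr n x) * d0 n x = ennreal (min (l0 * joint_density f0 n x) (l1 * joint_density f1 n x))"
proof (cases "joint_density f0 n x > 0")
  case True
  have "l1 * (joint_density f1 n x / joint_density f0 n x) * joint_density f0 n x = l1 * joint_density f1 n x"
    using True by simp
  then have "min l0 (l1 * (joint_density f1 n x / joint_density f0 n x)) * joint_density f0 n x =
      min (l0 * joint_density f0 n x) (l1 * joint_density f1 n x)"
    using True by (simp add: min_mult_distrib_right)
  moreover have "g (lr n x) = ennreal (min l0 (l1 * (joint_density f1 n x / joint_density f0 n x)))"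
    using True l0 l1 joint_density_nonneg(2)[OF assms]
    by (simp add: stop_loss_def lik_ratio_def ennreal_mult[symmetric] min_def)
  ultimately show ?thesis
    using True l0 l1 joint_density_nonneg(2)[OF assms] by (simp add: ennreal_mult[symmetric])
next
  case False
  then show ?thesis
    using joint_density_nonneg[OF assms] l1 by (simp add: ennreal_neg min_def)
qed

definition lagrangian :: "'a rule \<Rightarrow> 'a rule \<Rightarrow> ennreal" where
  "lagrangian \<psi> \<phi> = K0 M f0 G p c \<psi> + ennreal l0 * alpha M f0 G p \<psi> \<phi> + ennreal l1 * beta M f1 G p \<psi> \<phi>"

lemma adapted_test_functions:
  assumes "\<psi> \<in> rules M G" "\<phi> \<in> rules M G" "1 \<le> k"
  shows "adapted k (\<lambda>n x. cost n * (ennreal (stop_prob \<psi> n x) * d0 n x))"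
    "adapted k (\<lambda>n x. ennreal (stop_prob \<psi> n x * \<phi> n x) * d0 n x)"
    "adapted k (\<lambda>n x. ennreal (stop_prob \<psi> n x * (1 - \<phi> n x)) * ennreal (joint_density f1 n x))"
    "adapted k (decision_excess \<psi> \<phi>)"
proof -
  have [measurable]: "stop_prob \<psi> n \<in> borel_measurable (sample_space M n)"
    "\<phi> n \<in> borel_measurable (sample_space M n)" if "n \<in> size_vectors G k" for n
    using rules_measurable stop_prob_measurable assms that by blast+
  show "adapted k (\<lambda>n x. cost n * (ennreal (stop_prob \<psi> n x) * d0 n x))"
    "adapted k (\<lambda>n x. ennreal (stop_prob \<psi> n x * \<phi> n x) * d0 n x)"
    "adapted k (\<lambda>n x. ennreal (stop_prob \<psi> n x * (1 - \<phi> n x)) * ennreal (joint_density f1 n x))"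
    "adapted k (decision_excess \<psi> \<phi>)"
    unfolding adapted_def decision_excess_def[abs_def]
    by (intro ballI; measurable)+
qed

lemma stage_lagrangian:
  assumes "\<psi> \<in> rules M G" "\<phi> \<in> rules M G" "1 \<le> k"
  shows "J k (\<lambda>n x. cost n * (ennreal (stop_prob \<psi> n x) * d0 n x)) +
      ennreal l0 * J k (\<lambda>n x. ennreal (stop_prob \<psi> n x * \<phi> n x) * d0 n x) +
      ennreal l1 * J k (\<lambda>n x. ennreal (stop_prob \<psi> n x * (1 - \<phi> n x)) * ennreal (joint_density f1 n x)) =
    J k (stop_total \<psi>) + J k (decision_excess \<psi> \<phi>)"
proof -
  note adapted = adapted_test_functions[OF assms]
  have adapted': "adapted k (\<lambda>n x. ennreal l0 * (ennreal (stop_prob \<psi> n x * \<phi> n x) * d0 n x))"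
    "adapted k (\<lambda>n x. ennreal l1 * (ennreal (stop_prob \<psi> n x * (1 - \<phi> n x)) * ennreal (joint_density f1 n x)))"
    using adapted(2,3) unfolding adapted_def by auto
  have adapted_sum: "adapted k (\<lambda>n x. cost n * (ennreal (stop_prob \<psi> n x) * d0 n x) + ennreal l0 * (ennreal (stop_prob \<psi> n x * \<phi> n x) * d0 n x))"
    using adapted(1) adapted'(1) unfolding adapted_def by (intro ballI borel_measurable_add) blast+
  show ?thesis
    unfolding J_cmult[OF adapted(2), symmetric] J_cmult[OF adapted(3), symmetric]
      J_add[OF adapted(1) adapted'(1), symmetric] J_add[OF adapted_sum adapted'(2), symmetric]
      J_add[OF adapted_rule_functions(1)[OF assms(1,3)] adapted(4), symmetric]
  proof (rule J_cong)
    fix n x assume n: "n \<in> size_vectors G k" and x: "x \<in> space (sample_space M n)"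
    \<comment> \<open>\<open>a\<close> is the weighted density paid for rejecting, \<open>b\<close>
      the one paid for accepting; the average paid is \<open>min a b\<close> plus a nonnegative
      gap.\<close>
    define s a b where "s = stop_prob \<psi> n x" and "a = l0 * joint_density f0 n x" and "b = l1 * joint_density f1 n x"
    have ab: "0 \<le> a" "0 \<le> b" using joint_density_nonneg[OF x] l0 l1 by (simp_all add: a_def b_def)
    have s: "0 \<le> s" using stop_prob_nonneg[OF assms(1) n assms(3) x] by (simp add: s_def)
    note \<phi> = rules_bounds[OF assms(2) n assms(3) x]
    have "ennreal l0 * (ennreal (s * \<phi> n x) * d0 n x) = ennreal (s * (a * \<phi> n x))"
      using joint_density_nonneg[OF x] l0 s \<phi> by (simp add: ennreal_mult[symmetric] a_def mult_ac)
    moreover have "ennreal l1 * (ennreal (s * (1 - \<phi> n x)) * ennreal (joint_density f1 n x)) = ennreal (s * (b * (1 - \<phi> n x)))"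
      using joint_density_nonneg[OF x] l1 s \<phi> by (simp add: ennreal_mult[symmetric] b_def mult_ac)
    moreover have "ennreal s * (g (lr n x) * d0 n x) + ennreal (s * (a * \<phi> n x + b * (1 - \<phi> n x) - min a b)) =
        ennreal (s * (a * \<phi> n x)) + ennreal (s * (b * (1 - \<phi> n x)))"
    proof -
      let ?gap = "a * \<phi> n x + b * (1 - \<phi> n x) - min a b"
      have "0 \<le> s * ?gap" "0 \<le> s * min a b" "0 \<le> s * (a * \<phi> n x)" "0 \<le> s * (b * (1 - \<phi> n x))"
        using min_le_convex_combination[OF \<phi>, of a b] s ab \<phi> by simp_all
      moreover have "s * min a b + s * ?gap = s * (a * \<phi> n x) + s * (b * (1 - \<phi> n x))"
        by (simp add: algebra_simps)
      moreover have "ennreal s * ennreal (min a b) = ennreal (s * min a b)"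
        using s ab by (simp add: ennreal_mult)
      ultimately show ?thesis
        unfolding stop_loss_joint[OF x] a_def[symmetric] b_def[symmetric] by (metis ennreal_plus)
    qed
    ultimately show "cost n * (ennreal (stop_prob \<psi> n x) * d0 n x) + ennreal l0 * (ennreal (stop_prob \<psi> n x * \<phi> n x) * d0 n x) +
      ennreal l1 * (ennreal (stop_prob \<psi> n x * (1 - \<phi> n x)) * ennreal (joint_density f1 n x)) =
      stop_total \<psi> n x + decision_excess \<psi> \<phi> n x"
      unfolding stop_total_def decision_excess_def s_def[symmetric] a_def[symmetric] b_def[symmetric]
      by (simp add: distrib_left distrib_right ac_simps)
  qed
qed

lemma
  assumes "\<psi> \<in> truncated_rules M G N"
  shows K0_stages: "K0 M f0 G p c \<psi> = (\<Sum>k=1..N. J k (\<lambda>n x. cost n * (ennreal (stop_prob \<psi> n x) * d0 n x)))"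
    and alpha_stages: "alpha M f0 G p \<psi> \<phi> = (\<Sum>k=1..N. J k (\<lambda>n x. ennreal (stop_prob \<psi> n x * \<phi> n x) * d0 n x))"
    and beta_stages: "beta M f1 G p \<psi> \<phi> =
      (\<Sum>k=1..N. J k (\<lambda>n x. ennreal (stop_prob \<psi> n x * (1 - \<phi> n x)) * ennreal (joint_density f1 n x)))"
proof -
  have zero: "stop_prob \<psi> n x = 0" if "N < k" "n \<in> size_vectors G k" "x \<in> space (sample_space M n)" for k n x
    using continue_prob_after_truncation[OF assms that(2,3,1)] by (simp add: stop_prob_def)
  show "alpha M f0 G p \<psi> \<phi> = (\<Sum>k=1..N. J k (\<lambda>n x. ennreal (stop_prob \<psi> n x * \<phi> n x) * d0 n x))"
    unfolding alpha_def expect_def by (rule infsum_stages) (simp add: zero)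
  show "beta M f1 G p \<psi> \<phi> =
      (\<Sum>k=1..N. J k (\<lambda>n x. ennreal (stop_prob \<psi> n x * (1 - \<phi> n x)) * ennreal (joint_density f1 n x)))"
    unfolding beta_def expect_def by (rule infsum_stages) (simp add: zero)
  have "K0 M f0 G p c \<psi> = (\<Sum>\<^sub>\<infinity>k\<in>{1..}. \<Sum>\<^sub>\<infinity>n\<in>size_vectors G k. ennreal (size_prob p n) *
      (\<integral>\<^sup>+x. cost n * (ennreal (stop_prob \<psi> n x) * d0 n x) \<partial>sample_space M n))"
    unfolding K0_def
  proof (intro infsum_cong)
    fix k n assume k: "k \<in> {1::nat..}" and n: "n \<in> size_vectors G k"
    have [measurable]: "stop_prob \<psi> n \<in> borel_measurable (sample_space M n)"
      using stop_prob_measurable[OF truncated_rules_in_rules[OF assms] n] k by simp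
    show "ennreal (size_prob p n) * ennreal (\<Sum>i<k. c (n ! i)) * expect M f0 n (\<lambda>x. ennreal (stop_prob \<psi> n x)) =
      ennreal (size_prob p n) * (\<integral>\<^sup>+x. cost n * (ennreal (stop_prob \<psi> n x) * d0 n x) \<partial>sample_space M n)"
      using n by (subst nn_integral_cmult) (auto simp: expect_def cost_def size_vectors_def mult.assoc)
  qed
  also have "\<dots> = (\<Sum>k=1..N. J k (\<lambda>n x. cost n * (ennreal (stop_prob \<psi> n x) * d0 n x)))"
    by (rule infsum_stages) (simp add: zero)
  finally show "K0 M f0 G p c \<psi> = (\<Sum>k=1..N. J k (\<lambda>n x. cost n * (ennreal (stop_prob \<psi> n x) * d0 n x)))" .
qed

lemma lagrangian_decomposition:
  assumes "\<psi> \<in> truncated_rules M G N" "\<phi> \<in> rules M G"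
  shows "lagrangian \<psi> \<phi> = total_bound \<psi> 1 + ((\<Sum>k\<in>{1..<N}. J k (stop_excess \<psi> k)) + (\<Sum>k=1..N. J k (decision_excess \<psi> \<phi>)))"
proof -
  have "lagrangian \<psi> \<phi> = (\<Sum>k=1..N. J k (stop_total \<psi>) + J k (decision_excess \<psi> \<phi>))"
    unfolding lagrangian_def K0_stages[OF assms(1)] alpha_stages[OF assms(1)] beta_stages[OF assms(1)]
      sum_distrib_left sum.distrib[symmetric]
    by (intro sum.cong refl stage_lagrangian truncated_rules_in_rules[OF assms(1)] assms(2)) auto
  then show ?thesis by (simp only: sum.distrib sum_stop_total[OF assms(1)] add.assoc)
qed

section \<open>Optimality conditions as vanishing losses\<close>

text \<open>If g < q, every bit of continuation is a loss; if q < g, every bit of stopping is; a tie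
  leaves \<psi> free. These are the cases of \<open>between_indicators\<close>.\<close>

lemma stop_excess_eq_0_iff:
  assumes "\<psi> \<in> rules M G" "n \<in> size_vectors G k" "1 \<le> k" "k < N" "x \<in> space (sample_space M n)"
  shows "stop_excess \<psi> k n x = 0 \<longleftrightarrow>
    (continue_prob \<psi> n x > 0 \<and> joint_density f0 n x > 0 \<longrightarrow>
      between_indicators (\<psi> n x) (g (lr n x)) (q k (lr n x)))"
proof -
  note bounds = rules_bounds[OF assms(1-3,5)]
  \<comment> \<open>In \<open>ennreal\<close> infinity minus itself is not 0, so the differences
    with \<open>v k\<close> vanish as intended only for finite values.\<close>
  have "g (lr n x) < \<top>" unfolding stop_loss_def by (simp add: min_less_iff_disj)
  then show ?thesis
    using bounds continue_prob_bounds(1)[OF assms(1,2,5)] joint_density_nonneg(1)[OF assms(5)]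
    by (cases "g (lr n x) < q k (lr n x)"; cases "q k (lr n x) < g (lr n x)")
      (auto simp: stop_excess_def between_indicators_def V_before[OF assms(4)] ennreal_eq_0_iff min_def
        diff_eq_0_iff_ennreal less_le)
qed

text \<open>The loss constrains the decision wherever at least one density is positive; where both
  vanish it is 0 for any decision.\<close>

lemma decision_excess_eq_0_iff:
  assumes "\<psi> \<in> rules M G" "\<phi> \<in> rules M G" "n \<in> size_vectors G k" "1 \<le> k" "x \<in> space (sample_space M n)"
  shows "decision_excess \<psi> \<phi> n x = 0 \<longleftrightarrow>
    (stop_prob \<psi> n x > 0 \<and> (joint_density f0 n x > 0 \<or> joint_density f1 n x > 0) \<longrightarrow>
      between_indicators (\<phi> n x) (ennreal (l0 / l1)) (lr n x))"
proof -
  define s a b u where "s = stop_prob \<psi> n x" and "a = joint_density f0 n x" and "b = joint_density f1 n x"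
    and "u = \<phi> n x"
  have u: "0 \<le> u" "u \<le> 1" using rules_bounds[OF assms(2-5)] by (simp_all add: u_def)
  have ab: "0 \<le> a" "0 \<le> b" using joint_density_nonneg[OF assms(5)] by (simp_all add: a_def b_def)
  have s: "0 \<le> s" using stop_prob_nonneg[OF assms(1,3-5)] by (simp add: s_def)
  \<comment> \<open>The gap is the distance between the two weighted densities times the probability
    of the worse decision.\<close>
  have gap: "l0 * a * u + l1 * b * (1 - u) - min (l0 * a) (l1 * b) =
      (if l0 * a < l1 * b then (l1 * b - l0 * a) * (1 - u) else (l0 * a - l1 * b) * u)"
    by (simp add: min_def algebra_simps)
  have "0 \<le> l0 * a * u + l1 * b * (1 - u) - min (l0 * a) (l1 * b)"
    using min_le_convex_combination[OF u, of "l0 * a" "l1 * b"] by simp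
  then have "decision_excess \<psi> \<phi> n x = 0 \<longleftrightarrow> s = 0 \<or> l0 * a * u + l1 * b * (1 - u) - min (l0 * a) (l1 * b) = 0"
    unfolding decision_excess_def s_def[symmetric] a_def[symmetric] b_def[symmetric] u_def[symmetric]
    using s by (simp add: ennreal_eq_0_iff mult_le_0_iff order.antisym_conv2) (auto simp: order.order_iff_strict)
  also have "\<dots> \<longleftrightarrow> (s > 0 \<longrightarrow> (l0 * a < l1 * b \<longrightarrow> u = 1) \<and> (l1 * b < l0 * a \<longrightarrow> u = 0))"
    unfolding gap using s by auto
  also have "\<dots> \<longleftrightarrow> (s > 0 \<and> (a > 0 \<or> b > 0) \<longrightarrow> between_indicators u (ennreal (l0 / l1)) (lr n x))"
  proof (cases "a > 0")
    case True
    have "l0 / l1 < b / a \<longleftrightarrow> l0 * a < l1 * b" "l0 / l1 \<le> b / a \<longleftrightarrow> l0 * a \<le> l1 * b"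
      using True l1 by (simp_all add: field_simps)
    moreover have "lr n x = ennreal (b / a)" using True by (simp add: lik_ratio_def a_def b_def)
    ultimately show ?thesis
      using True u ab l0 l1 by (auto simp: between_indicators_def ennreal_less_iff ennreal_le_iff of_bool_def split: if_splits)
  next
    \<comment> \<open>With \<open>f0\<close> zero and \<open>f1\<close> positive the ratio is
      infinite, and both formulations demand certain rejection.\<close>
    case False
    then have "a = 0" using ab by simp
    moreover have "lr n x = (if b > 0 then \<infinity> else 0)" using False by (simp add: lik_ratio_def a_def b_def)
    ultimately show ?thesis
      using u ab l0 l1
      by (auto simp: between_indicators_def of_bool_def zero_less_mult_iff mult_less_0_iff)
  qed
  finally show ?thesis by (simp add: s_def a_def b_def u_def)
qed

lemma cond_S_iff:
  assumes "\<psi> \<in> rules M G"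
  shows "cond_S M f0 f1 G p c l0 l1 N \<psi> \<longleftrightarrow> (\<forall>k\<in>{1..<N}. J k (stop_excess \<psi> k) = 0)"
proof -
  have "(AE x in sample_space M n. continue_prob \<psi> n x > 0 \<and> joint_density f0 n x > 0 \<longrightarrow>
       between_indicators (\<psi> n x) (g (lr n x)) (q k (lr n x))) \<longleftrightarrow>
     (AE x in sample_space M n. stop_excess \<psi> k n x = 0)"
    if "1 \<le> k" "k < N" "n \<in> pos_size_vectors G p k" for k n
    using that assms
    by (intro AE_cong) (auto simp: stop_excess_eq_0_iff pos_size_vectors_def)
  then show ?thesis
    unfolding cond_S_def
    using J_eq_0_iff[OF adapted_rule_functions(5)[OF assms]] by auto
qed

text \<open>The conditions under \<open>f0\<close> and \<open>f1\<close> together cover the set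
  where either density is positive. Stages beyond N carry no stopped mass.\<close>

lemma cond_D_iff:
  assumes "\<psi> \<in> truncated_rules M G N" "\<phi> \<in> rules M G"
  shows "cond_D M f0 f0 f1 G p l0 l1 \<psi> \<phi> \<and> cond_D M f1 f0 f1 G p l0 l1 \<psi> \<phi> \<longleftrightarrow>
    (\<forall>k\<in>{1..N}. J k (decision_excess \<psi> \<phi>) = 0)"
proof -
  note \<psi> = truncated_rules_in_rules[OF assms(1)]
  have 1: "(AE x in sample_space M n. stop_prob \<psi> n x > 0 \<and> joint_density f0 n x > 0 \<longrightarrow>
       between_indicators (\<phi> n x) (ennreal (l0 / l1)) (lr n x)) \<and>
     (AE x in sample_space M n. stop_prob \<psi> n x > 0 \<and> joint_density f1 n x > 0 \<longrightarrow>
       between_indicators (\<phi> n x) (ennreal (l0 / l1)) (lr n x)) \<longleftrightarrow>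
     (AE x in sample_space M n. decision_excess \<psi> \<phi> n x = 0)"
    if "1 \<le> k" "n \<in> pos_size_vectors G p k" for k n
    unfolding AE_conj_iff[symmetric] using that
    by (intro AE_cong) (auto simp: decision_excess_eq_0_iff[OF \<psi> assms(2)] pos_size_vectors_def)
  have 2: "AE x in sample_space M n. decision_excess \<psi> \<phi> n x = 0"
    if "N < k" "n \<in> pos_size_vectors G p k" for k n
    using continue_prob_after_truncation[OF assms(1)] that
    by (intro AE_I2) (auto simp: decision_excess_def stop_prob_def pos_size_vectors_def)
  have "cond_D M f0 f0 f1 G p l0 l1 \<psi> \<phi> \<and> cond_D M f1 f0 f1 G p l0 l1 \<psi> \<phi> \<longleftrightarrow>
      (\<forall>k\<ge>1. \<forall>n\<in>pos_size_vectors G p k. AE x in sample_space M n. decision_excess \<psi> \<phi> n x = 0)"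
    unfolding cond_D_def using 1 by blast
  also have "\<dots> \<longleftrightarrow> (\<forall>k\<in>{1..N}. \<forall>n\<in>pos_size_vectors G p k. AE x in sample_space M n. decision_excess \<psi> \<phi> n x = 0)"
    using 2 by (meson atLeastAtMost_iff not_le)
  also have "\<dots> \<longleftrightarrow> (\<forall>k\<in>{1..N}. J k (decision_excess \<psi> \<phi>) = 0)"
    using J_eq_0_iff[OF adapted_test_functions(4)[OF \<psi> assms(2)]] by auto
  finally show ?thesis .
qed

lemma total_bound_le_lagrangian:
  assumes "(\<psi>, \<phi>) \<in> truncated_tests M G N"
  shows "total_bound \<psi>' 1 \<le> lagrangian \<psi> \<phi>"
  using assms lagrangian_decomposition[of \<psi> \<phi>] total_bound_1[of \<psi> \<psi>']
  by (simp add: truncated_tests_def)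

text \<open>The finite bound cancels, and a finite sum of nonnegative losses vanishes iff each of
  them does.\<close>

lemma lagrangian_eq_bound_iff:
  assumes "(\<psi>, \<phi>) \<in> truncated_tests M G N"
  shows "lagrangian \<psi> \<phi> = total_bound \<psi> 1 \<longleftrightarrow> cond_S M f0 f1 G p c l0 l1 N \<psi> \<and>
    cond_D M f0 f0 f1 G p l0 l1 \<psi> \<phi> \<and> cond_D M f1 f0 f1 G p l0 l1 \<psi> \<phi>"
proof -
  have \<psi>: "\<psi> \<in> truncated_rules M G N" "\<phi> \<in> rules M G" using assms by (simp_all add: truncated_tests_def)
  have cancel: "a + b = a \<longleftrightarrow> b = 0" if "a < \<top>" for a b :: ennreal
    using that by (metis add.right_neutral ennreal_add_left_cancel infinity_ennreal_def less_irrefl)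
  show ?thesis
    unfolding lagrangian_decomposition[OF \<psi>] cancel[OF total_bound_1_finite]
      cond_D_iff[OF \<psi>] cond_S_iff[OF truncated_rules_in_rules[OF \<psi>(1)]]
    by (simp add: sum_nonneg_eq_0_iff)
qed

end

end

theorem corollary4p1:
  fixes M :: "'a measure" and f0 f1 :: "'a \<Rightarrow> real" and G :: "nat set"
    and p :: "nat \<Rightarrow> nat pmf" and c :: "nat \<Rightarrow> real" and l0 l1 :: real and N :: nat
    and \<psi> \<phi> :: "'a rule"
  assumes "group_sequential_model M f0 f1 G p c"
    and "l0 > 0" and "l1 > 0" and "N \<ge> 1"
    and "(\<psi>, \<phi>) \<in> truncated_tests M G N"
    and "cond_S M f0 f1 G p c l0 l1 N \<psi>"
    and "cond_D M f0 f0 f1 G p l0 l1 \<psi> \<phi>"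
    and "cond_D M f1 f0 f1 G p l0 l1 \<psi> \<phi>"
  shows "\<forall>(\<psi>', \<phi>') \<in> truncated_tests M G N.
    alpha M f0 G p \<psi>' \<phi>' \<le> alpha M f0 G p \<psi> \<phi> \<and> beta M f1 G p \<psi>' \<phi>' \<le> beta M f1 G p \<psi> \<phi> \<longrightarrow>
      K0 M f0 G p c \<psi>' \<ge> K0 M f0 G p c \<psi> \<and>
      (alpha M f0 G p \<psi>' \<phi>' < alpha M f0 G p \<psi> \<phi> \<or> beta M f1 G p \<psi>' \<phi>' < beta M f1 G p \<psi> \<phi> \<longrightarrow>
        K0 M f0 G p c \<psi>' > K0 M f0 G p c \<psi>) \<and>
      (alpha M f0 G p \<psi>' \<phi>' = alpha M f0 G p \<psi> \<phi> \<and> beta M f1 G p \<psi>' \<phi>' = beta M f1 G p \<psi> \<phi> \<and>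
        K0 M f0 G p c \<psi>' = K0 M f0 G p c \<psi> \<longrightarrow>
        cond_S M f0 f1 G p c l0 l1 N \<psi>' \<and>
        cond_D M f0 f0 f1 G p l0 l1 \<psi>' \<phi>' \<and> cond_D M f1 f0 f1 G p l0 l1 \<psi>' \<phi>')"
proof (clarify, intro conjI impI; (elim conjE)?)
  interpret group_sequential_model M f0 f1 G p c by fact
  note N = assms(2-4)
  have opt: "lagrangian l0 l1 \<psi> \<phi> = total_bound l0 l1 N \<psi> 1"
    using lagrangian_eq_bound_iff[OF N assms(5)] assms(6-8) by simp
  fix \<psi>' \<phi>'
  assume test': "(\<psi>', \<phi>') \<in> truncated_tests M G N"
    and alpha: "alpha M f0 G p \<psi>' \<phi>' \<le> alpha M f0 G p \<psi> \<phi>"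
    and beta: "beta M f1 G p \<psi>' \<phi>' \<le> beta M f1 G p \<psi> \<phi>"
  have bound: "lagrangian l0 l1 \<psi> \<phi> \<le> lagrangian l0 l1 \<psi>' \<phi>'" "lagrangian l0 l1 \<psi> \<phi> < \<top>"
    unfolding opt by (rule total_bound_le_lagrangian[OF N test'] total_bound_1_finite[OF N])+
  have l: "ennreal l0 \<noteq> 0" "ennreal l0 \<noteq> \<top>" "ennreal l1 \<noteq> 0" "ennreal l1 \<noteq> \<top>"
    using assms(2,3) by (simp_all add: ennreal_eq_0_iff)
  note compare = ennreal_weighted_sum_cancel[OF bound[unfolded lagrangian_def[OF N]] alpha beta l]
  show "K0 M f0 G p c \<psi> \<le> K0 M f0 G p c \<psi>'" by (rule compare(1))
  show "K0 M f0 G p c \<psi> < K0 M f0 G p c \<psi>'"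
    if "alpha M f0 G p \<psi>' \<phi>' < alpha M f0 G p \<psi> \<phi> \<or> beta M f1 G p \<psi>' \<phi>' < beta M f1 G p \<psi> \<phi>"
    using that by (rule compare(2))
  assume "alpha M f0 G p \<psi>' \<phi>' = alpha M f0 G p \<psi> \<phi>" "beta M f1 G p \<psi>' \<phi>' = beta M f1 G p \<psi> \<phi>"
    "K0 M f0 G p c \<psi>' = K0 M f0 G p c \<psi>"
  \<comment> \<open>Equal errors and costs give equal weighted sums, so the other test attains the
    same minimum.\<close>
  then have "lagrangian l0 l1 \<psi>' \<phi>' = total_bound l0 l1 N \<psi>' 1"
    using opt total_bound_1[OF N, of \<psi> \<psi>'] unfolding lagrangian_def[OF N] by simp
  then show "cond_S M f0 f1 G p c l0 l1 N \<psi>'" "cond_D M f0 f0 f1 G p l0 l1 \<psi>' \<phi>'" "cond_D M f1 f0 f1 G p l0 l1 \<psi>' \<phi>'"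
    using lagrangian_eq_bound_iff[OF N test'] by blast+
qed

end
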